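(* If $i=1,2,\ldots$, then $\sigma_{i+\frac12}s_i=s_i\sigma_{i+\frac12}=\sigma_{i+1}$.
   Context: Partition algebras. For an integer $k\ge1$ let $A_k$ be the set of all set partitions of $\{1,\ldots,k,1',\ldots,k'\}$, and let $A_{k-\frac12}\subseteq A_k$ be the subset of those in which $k$ and $k'$ lie in the same block. A partition is drawn as a graph with top vertices $1,\ldots,k$ and bottom vertices $1',\ldots,k'$, whose connected components are the blocks. For $\rho_1,\rho_2\in A_k$, $\rho_1\circ\rho_2\in A_k$ is obtained by placing $\rho_1$ above $\rho_2$, identifying the bottom row of $\rho_1$ with the top row of $\rho_2$, and deleting components contained entirely in the middle row. Let $R=\mathbb{Z}[z]$, $z$ an indeterminate. $\mathcal{A}_k(z)$ is the free $R$-module on $A_k$ with product $\rho_1\rho_2=z^{\ell}\,\rho_1\circ\rho_2$, where $\ell$ is the number of components deleted from the middle row; $\mathcal{A}_{k-\frac12}(z)$ is the subalgebra generated by $A_{k-\frac12}$, and $\mathcal{A}_0(z)=R$. Adding the block $\{k+1,(k+1)'\}$ embeds $\mathcal{A}_k(z)$ in $\mathcal{A}_{k+\frac12}(z)\subseteq\mathcal{A}_{k+1}(z)$; all identities are understood in $\mathcal{A}_k(z)$ for $k$ large enough to contain the elements involved. Elements: $s_i$ ($i\ge1$) has blocks $\{i,(i+1)'\},\{i+1,i'\}$ and $\{m,m'\}$ for $m\ne i,i+1$; $p_j$ ($j\ge1$) has blocks $\{j\},\{j'\}$ and $\{m,m'\}$ for $m\ne j$; $p_{i+\frac12}$ ($i\ge1$)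 has blocks $\{i,i+1,i',(i+1)'\}$ and $\{m,m'\}$ for $m\neq i,i+1$. Recursive definitions. $L_0=0$, $L_1=p_1$, $\sigma_1=1$, $\sigma_2=s_1$, and $L_{i+1}=-s_iL_ip_{i+\frac12}-p_{i+\frac12}L_is_i+p_{i+\frac12}L_ip_{i+1}p_{i+\frac12}+s_iL_is_i+\sigma_{i+1}$ for $i\ge1$, where for $i\ge2$ $\sigma_{i+1}=s_{i-1}s_i\sigma_is_is_{i-1}+s_ip_{i-\frac12}L_{i-1}s_ip_{i-\frac12}s_i+p_{i-\frac12}L_{i-1}s_ip_{i-\frac12}-s_ip_{i-\frac12}L_{i-1}s_{i-1}p_{i+\frac12}p_ip_{i-\frac12}-p_{i-\frac12}p_ip_{i+\frac12}s_{i-1}L_{i-1}p_{i-\frac12}s_i.$ Also $\sigma_{\frac12}=1$, $\sigma_{1+\frac12}=1$, and for $i\ge2$ $\sigma_{i+\frac12}=s_{i-1}s_i\sigma_{i-\frac12}s_is_{i-1}+p_{i-\frac12}L_{i-1}s_ip_{i-\frac12}s_i+s_ip_{i-\frac12}L_{i-1}s_ip_{i-\frac12}-p_{i-\frac12}L_{i-1}s_{i-1}p_{i+\frac12}p_ip_{i-\frac12}-s_ip_{i-\frac12}p_ip_{i+\frac12}s_{i-1}L_{i-1}p_{i-\frac12}s_i.$ *)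

theory Defs
  imports
    "HOL-Library.Disjoint_Sets"
    "HOL-Library.Poly_Mapping"
    "HOL-Computational_Algebra.Polynomial"
begin

section \<open>Set partitions and their composition\<close>

text \<open>
  \<open>Top m\<close> and \<open>Bot m\<close> stand for the vertices \<open>m\<close> and \<open>m'\<close> of a diagram. \<open>Mid m\<close> occurs only
  while two diagrams are stacked; it is the vertex obtained by identifying a bottom vertex of
  the upper diagram with a top vertex of the lower one.
\<close>

datatype vertex = Top nat | Mid nat | Bot nat

type_synonym diagram = "vertex set set"

definition diagrams :: "nat \<Rightarrow> diagram set" where
  "diagrams k = {\<rho>. partition_on (Top ` {1..k} \<union> Bot ` {1..k}) \<rho>}"

fun to_upper :: "vertex \<Rightarrow> vertex" where
  "to_upper (Bot m) = Mid m"
| "to_upper v = v"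

fun to_lower :: "vertex \<Rightarrow> vertex" where
  "to_lower (Top m) = Mid m"
| "to_lower v = v"

definition stacked_blocks :: "diagram \<Rightarrow> diagram \<Rightarrow> vertex set set" where
  "stacked_blocks \<rho>\<^sub>1 \<rho>\<^sub>2 = (`) to_upper ` \<rho>\<^sub>1 \<union> (`) to_lower ` \<rho>\<^sub>2"

definition stacked_graph :: "diagram \<Rightarrow> diagram \<Rightarrow> (vertex \<times> vertex) set" where
  "stacked_graph \<rho>\<^sub>1 \<rho>\<^sub>2 = (\<Union>B \<in> stacked_blocks \<rho>\<^sub>1 \<rho>\<^sub>2. B \<times> B)"

definition stacked_components :: "diagram \<Rightarrow> diagram \<Rightarrow> vertex set set" where
  "stacked_components \<rho>\<^sub>1 \<rho>\<^sub>2 = \<Union>(stacked_blocks \<rho>\<^sub>1 \<rho>\<^sub>2) // (stacked_graph \<rho>\<^sub>1 \<rho>\<^sub>2)\<^sup>*"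

definition compose :: "diagram \<Rightarrow> diagram \<Rightarrow> diagram" where
  "compose \<rho>\<^sub>1 \<rho>\<^sub>2 =
     {C - range Mid | C. C \<in> stacked_components \<rho>\<^sub>1 \<rho>\<^sub>2 \<and> \<not> C \<subseteq> range Mid}"

definition loops :: "diagram \<Rightarrow> diagram \<Rightarrow> nat" where
  "loops \<rho>\<^sub>1 \<rho>\<^sub>2 = card {C \<in> stacked_components \<rho>\<^sub>1 \<rho>\<^sub>2. C \<subseteq> range Mid}"

lemma sym_stacked: "sym ((stacked_graph \<rho>\<^sub>1 \<rho>\<^sub>2)\<^sup>*)"
  by (intro sym_rtrancl) (auto simp: sym_def stacked_graph_def)

lemma rtrancl_stacked_subset:
  "(v, w) \<in> (stacked_graph \<rho>\<^sub>1 \<rho>\<^sub>2)\<^sup>* \<Longrightarrow> v \<in> \<Union>(stacked_blocks \<rho>\<^sub>1 \<rho>\<^sub>2)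
     \<Longrightarrow> w \<in> \<Union>(stacked_blocks \<rho>\<^sub>1 \<rho>\<^sub>2)"
  by (induction rule: rtrancl_induct) (auto simp: stacked_graph_def)

lemma partition_on_stacked_components:
  "partition_on (\<Union>(stacked_blocks \<rho>\<^sub>1 \<rho>\<^sub>2)) (stacked_components \<rho>\<^sub>1 \<rho>\<^sub>2)"
proof (rule partition_onI)
  show "\<Union>(stacked_components \<rho>\<^sub>1 \<rho>\<^sub>2) = \<Union>(stacked_blocks \<rho>\<^sub>1 \<rho>\<^sub>2)"
    unfolding stacked_components_def quotient_def
    using rtrancl_stacked_subset[of _ _ \<rho>\<^sub>1 \<rho>\<^sub>2] by blast
next
  fix C D assume "C \<in> stacked_components \<rho>\<^sub>1 \<rho>\<^sub>2" "D \<in> stacked_components \<rho>\<^sub>1 \<rho>\<^sub>2" "C \<noteq> D"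
  then obtain v w where C: "C = (stacked_graph \<rho>\<^sub>1 \<rho>\<^sub>2)\<^sup>* `` {v}"
    and D: "D = (stacked_graph \<rho>\<^sub>1 \<rho>\<^sub>2)\<^sup>* `` {w}"
    by (auto simp: stacked_components_def quotient_def)
  show "disjnt C D"
  proof (rule ccontr)
    assume "\<not> disjnt C D"
    then obtain u where "(v, u) \<in> (stacked_graph \<rho>\<^sub>1 \<rho>\<^sub>2)\<^sup>*" "(w, u) \<in> (stacked_graph \<rho>\<^sub>1 \<rho>\<^sub>2)\<^sup>*"
      using C D by (auto simp: disjnt_def)
    then have "(v, w) \<in> (stacked_graph \<rho>\<^sub>1 \<rho>\<^sub>2)\<^sup>*" "(w, v) \<in> (stacked_graph \<rho>\<^sub>1 \<rho>\<^sub>2)\<^sup>*"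
      using sym_stacked[of \<rho>\<^sub>1 \<rho>\<^sub>2] by (meson rtrancl_trans symE)+
    then have "C = D"
      unfolding C D by (meson Image_singleton_iff rtrancl_trans set_eqI)
    with \<open>C \<noteq> D\<close> show False by simp
  qed
next
  show "{} \<notin> stacked_components \<rho>\<^sub>1 \<rho>\<^sub>2"
    by (auto simp: stacked_components_def quotient_def)
qed

lemma stacked_vertices:
  assumes "\<rho>\<^sub>1 \<in> diagrams k" "\<rho>\<^sub>2 \<in> diagrams k"
  shows "\<Union>(stacked_blocks \<rho>\<^sub>1 \<rho>\<^sub>2) = Top ` {1..k} \<union> Mid ` {1..k} \<union> Bot ` {1..k}"
proof -
  have "\<Union>(stacked_blocks \<rho>\<^sub>1 \<rho>\<^sub>2) = to_upper ` \<Union>\<rho>\<^sub>1 \<union> to_lower ` \<Union>\<rho>\<^sub>2"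
    by (auto simp: stacked_blocks_def)
  also have "\<dots> = to_upper ` (Top ` {1..k} \<union> Bot ` {1..k}) \<union> to_lower ` (Top ` {1..k} \<union> Bot ` {1..k})"
    using assms by (simp add: diagrams_def partition_on_def)
  finally show ?thesis by (auto simp: image_Un image_image)
qed

lemma compose_in_diagrams:
  assumes "\<rho>\<^sub>1 \<in> diagrams k" "\<rho>\<^sub>2 \<in> diagrams k"
  shows "compose \<rho>\<^sub>1 \<rho>\<^sub>2 \<in> diagrams k"
proof -
  note P = partition_on_stacked_components[of \<rho>\<^sub>1 \<rho>\<^sub>2, unfolded stacked_vertices[OF assms]]
  have "partition_on (Top ` {1..k} \<union> Bot ` {1..k}) (compose \<rho>\<^sub>1 \<rho>\<^sub>2)"
  proof (rule partition_onI)
    have "\<Union>(compose \<rho>\<^sub>1 \<rho>\<^sub>2) = \<Union>(stacked_components \<rho>\<^sub>1 \<rho>\<^sub>2) - range Mid"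
      unfolding compose_def by blast
    also have "\<dots> = Top ` {1..k} \<union> Bot ` {1..k}"
      unfolding partition_onD1[OF P, symmetric] by auto
    finally show "\<Union>(compose \<rho>\<^sub>1 \<rho>\<^sub>2) = Top ` {1..k} \<union> Bot ` {1..k}" .
  next
    fix C D assume "C \<in> compose \<rho>\<^sub>1 \<rho>\<^sub>2" "D \<in> compose \<rho>\<^sub>1 \<rho>\<^sub>2" "C \<noteq> D"
    then obtain C' D' where "C = C' - range Mid" "D = D' - range Mid"
      "C' \<in> stacked_components \<rho>\<^sub>1 \<rho>\<^sub>2" "D' \<in> stacked_components \<rho>\<^sub>1 \<rho>\<^sub>2" "C' \<noteq> D'"
      by (auto simp: compose_def)
    then show "disjnt C D"
      using disjointD[OF partition_onD2[OF P], of C' D'] by (auto simp: disjnt_def)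
  next
    show "{} \<notin> compose \<rho>\<^sub>1 \<rho>\<^sub>2"
      by (auto simp: compose_def)
  qed
  then show ?thesis by (simp add: diagrams_def)
qed


section \<open>The partition algebra\<close>

text \<open>
  The ground ring \<open>\<int>[z]\<close> is \<^typ>\<open>int poly\<close>, and \<^term>\<open>monom 1 l :: int poly\<close> is \<open>z\<close> to the
  power \<open>l\<close>. Neither composition nor the number of deleted components needs to be told the
  number \<open>k\<close> of columns, so one product on finitely supported functions restricts to the
  product of every partition algebra.
\<close>

type_synonym element = "diagram \<Rightarrow>\<^sub>0 int poly"

definition partition_algebra :: "nat \<Rightarrow> element set" where
  "partition_algebra k = {x. Poly_Mapping.keys x \<subseteq> diagrams k}"

definition product :: "element \<Rightarrow> element \<Rightarrow> element" (infixl "\<cdot>" 70) where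
  "x \<cdot> y =
     (\<Sum>\<rho>\<^sub>1 \<in> Poly_Mapping.keys x. \<Sum>\<rho>\<^sub>2 \<in> Poly_Mapping.keys y.
        Poly_Mapping.single (compose \<rho>\<^sub>1 \<rho>\<^sub>2)
          (Poly_Mapping.lookup x \<rho>\<^sub>1 * Poly_Mapping.lookup y \<rho>\<^sub>2 * monom 1 (loops \<rho>\<^sub>1 \<rho>\<^sub>2)))"

definition basis :: "diagram \<Rightarrow> element" where
  "basis \<rho> = Poly_Mapping.single \<rho> 1"

lemma in_partition_algebra_0 [simp]: "0 \<in> partition_algebra k"
  by (simp add: partition_algebra_def)

lemma in_partition_algebra_add:
  "x \<in> partition_algebra k \<Longrightarrow> y \<in> partition_algebra k \<Longrightarrow> x + y \<in> partition_algebra k"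
  unfolding partition_algebra_def using Poly_Mapping.keys_add[of x y] by blast

lemma in_partition_algebra_uminus:
  "x \<in> partition_algebra k \<Longrightarrow> - x \<in> partition_algebra k"
  by (simp add: partition_algebra_def)

lemma in_partition_algebra_diff:
  "x \<in> partition_algebra k \<Longrightarrow> y \<in> partition_algebra k \<Longrightarrow> x - y \<in> partition_algebra k"
  using in_partition_algebra_add[of x k "- y"] in_partition_algebra_uminus[of y k] by simp

lemma in_partition_algebra_sum:
  "(\<And>a. a \<in> A \<Longrightarrow> f a \<in> partition_algebra k) \<Longrightarrow> sum f A \<in> partition_algebra k"
  by (induction A rule: infinite_finite_induct) (auto intro: in_partition_algebra_add)

lemma in_partition_algebra_product:
  assumes "x \<in> partition_algebra k" "y \<in> partition_algebra k"
  shows "x \<cdot> y \<in> partition_algebra k"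
  unfolding product_def
proof (intro in_partition_algebra_sum)
  fix a b assume "a \<in> Poly_Mapping.keys x" "b \<in> Poly_Mapping.keys y"
  then have "compose a b \<in> diagrams k"
    using assms by (intro compose_in_diagrams) (auto simp: partition_algebra_def)
  then show "Poly_Mapping.single (compose a b)
     (Poly_Mapping.lookup x a * Poly_Mapping.lookup y b * monom 1 (loops a b)) \<in> partition_algebra k"
    by (simp add: partition_algebra_def)
qed

lemma basis_in_partition_algebra: "basis \<rho> \<in> partition_algebra k \<longleftrightarrow> \<rho> \<in> diagrams k"
  by (simp add: partition_algebra_def basis_def)

definition verticals :: "nat set \<Rightarrow> diagram" where
  "verticals M = {{Top m, Bot m} | m. m \<in> M}"

definition unit_elt :: "nat \<Rightarrow> element" where
  "unit_elt k = basis (verticals {1..k})"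

text \<open>
  Below, the first argument \<open>k\<close> says in which partition algebra the element is taken. The
  generators with index \<open>i\<close> are those of the algebra on \<open>k\<close> columns for \<open>1 \<le> i < k\<close>
  (for \<open>p_gen\<close>: \<open>1 \<le> j \<le> k\<close>); \<open>p_half k i\<close> has index \<open>i + 1/2\<close>.
\<close>

definition s_gen :: "nat \<Rightarrow> nat \<Rightarrow> element" where
  "s_gen k i = basis ({{Top i, Bot (i + 1)}, {Top (i + 1), Bot i}} \<union> verticals ({1..k} - {i, i + 1}))"

definition p_gen :: "nat \<Rightarrow> nat \<Rightarrow> element" where
  "p_gen k j = basis ({{Top j}, {Bot j}} \<union> verticals ({1..k} - {j}))"

definition p_half :: "nat \<Rightarrow> nat \<Rightarrow> element" where
  "p_half k i =
     basis ({{Top i, Top (i + 1), Bot i, Bot (i + 1)}} \<union> verticals ({1..k} - {i, i + 1}))"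

lemma Union_verticals: "\<Union>(verticals M) = Top ` M \<union> Bot ` M"
  unfolding verticals_def by blast

lemma Un_verticals_in_diagrams:
  assumes P: "partition_on (Top ` N \<union> Bot ` N) P" and "N \<subseteq> {1..k}"
  shows "P \<union> verticals ({1..k} - N) \<in> diagrams k"
proof -
  have "\<Union>(P \<union> verticals ({1..k} - N)) = Top ` {1..k} \<union> Bot ` {1..k}"
    using \<open>N \<subseteq> {1..k}\<close> by (auto simp: Union_verticals simp flip: partition_onD1[OF P])
  moreover have "disjoint (verticals ({1..k} - N))"
    unfolding verticals_def disjoint_def by auto
  then have "disjoint (P \<union> verticals ({1..k} - N))"
    using partition_onD2[OF P] by (intro disjoint_union)
      (auto simp: Union_verticals simp flip: partition_onD1[OF P])
  moreover have "{} \<notin> P \<union> verticals ({1..k} - N)"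
    using partition_onD3[OF P] by (auto simp: verticals_def)
  ultimately show ?thesis
    by (simp add: diagrams_def partition_on_def)
qed

lemma unit_in_partition_algebra: "unit_elt k \<in> partition_algebra k"
  unfolding unit_elt_def basis_in_partition_algebra
  using Un_verticals_in_diagrams[of "{}" "{}" k] by (simp add: partition_on_def)

lemma s_gen_in_partition_algebra:
  assumes "1 \<le> i" "i < k" shows "s_gen k i \<in> partition_algebra k"
  unfolding s_gen_def basis_in_partition_algebra
  using assms by (intro Un_verticals_in_diagrams) (auto simp: partition_on_def disjoint_def)

lemma p_gen_in_partition_algebra:
  assumes "1 \<le> j" "j \<le> k" shows "p_gen k j \<in> partition_algebra k"
  unfolding p_gen_def basis_in_partition_algebra
  using assms by (intro Un_verticals_in_diagrams) (auto simp: partition_on_def disjoint_def)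

lemma p_half_in_partition_algebra:
  assumes "1 \<le> i" "i < k" shows "p_half k i \<in> partition_algebra k"
  unfolding p_half_def basis_in_partition_algebra
  using assms by (intro Un_verticals_in_diagrams) (auto simp: partition_on_def disjoint_def)

lemmas in_partition_algebra =
  in_partition_algebra_add in_partition_algebra_uminus in_partition_algebra_diff
  in_partition_algebra_product unit_in_partition_algebra s_gen_in_partition_algebra
  p_gen_in_partition_algebra p_half_in_partition_algebra


section \<open>The recursively defined elements\<close>

text \<open>
  In the recursive equations \<open>i\<close> is the index occurring in the mathematical recursion, so that
  the left-hand side has index \<open>i + 1\<close> for \<open>L_elt\<close> and \<open>sigma\<close>. There is no element \<open>sigma\<close>
  with index \<open>0\<close>; its value here is a dummy that is never used.
\<close>

fun L_elt :: "nat \<Rightarrow> nat \<Rightarrow> element" and sigma :: "nat \<Rightarrow> nat \<Rightarrow> element" where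
  "L_elt k 0 = 0"
| "L_elt k (Suc 0) = p_gen k 1"
| "L_elt k (Suc (Suc n)) =
    (let i = Suc n in
       - (s_gen k i \<cdot> L_elt k i \<cdot> p_half k i)
       - p_half k i \<cdot> L_elt k i \<cdot> s_gen k i
       + p_half k i \<cdot> L_elt k i \<cdot> p_gen k (i + 1) \<cdot> p_half k i
       + s_gen k i \<cdot> L_elt k i \<cdot> s_gen k i
       + sigma k (Suc i))"
| "sigma k 0 = 0"
| "sigma k (Suc 0) = unit_elt k"
| "sigma k (Suc (Suc 0)) = s_gen k 1"
| "sigma k (Suc (Suc (Suc n))) =
    (let i = Suc (Suc n) in
       s_gen k (i - 1) \<cdot> s_gen k i \<cdot> sigma k i \<cdot> s_gen k i \<cdot> s_gen k (i - 1)
       + s_gen k i \<cdot> p_half k (i - 1) \<cdot> L_elt k (i - 1) \<cdot> s_gen k i \<cdot> p_half k (i - 1) \<cdot> s_gen k i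
       + p_half k (i - 1) \<cdot> L_elt k (i - 1) \<cdot> s_gen k i \<cdot> p_half k (i - 1)
       - s_gen k i \<cdot> p_half k (i - 1) \<cdot> L_elt k (i - 1) \<cdot> s_gen k (i - 1) \<cdot> p_half k i
           \<cdot> p_gen k i \<cdot> p_half k (i - 1)
       - p_half k (i - 1) \<cdot> p_gen k i \<cdot> p_half k i \<cdot> s_gen k (i - 1) \<cdot> L_elt k (i - 1)
           \<cdot> p_half k (i - 1) \<cdot> s_gen k i)"

text \<open>\<open>sigma_half k i\<close> is the element \<open>sigma\<close> with index \<open>i + 1/2\<close>.\<close>

fun sigma_half :: "nat \<Rightarrow> nat \<Rightarrow> element" where
  "sigma_half k 0 = unit_elt k"
| "sigma_half k (Suc 0) = unit_elt k"
| "sigma_half k (Suc (Suc n)) =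
    (let i = Suc (Suc n) in
       s_gen k (i - 1) \<cdot> s_gen k i \<cdot> sigma_half k (i - 1) \<cdot> s_gen k i \<cdot> s_gen k (i - 1)
       + p_half k (i - 1) \<cdot> L_elt k (i - 1) \<cdot> s_gen k i \<cdot> p_half k (i - 1) \<cdot> s_gen k i
       + s_gen k i \<cdot> p_half k (i - 1) \<cdot> L_elt k (i - 1) \<cdot> s_gen k i \<cdot> p_half k (i - 1)
       - p_half k (i - 1) \<cdot> L_elt k (i - 1) \<cdot> s_gen k (i - 1) \<cdot> p_half k i
           \<cdot> p_gen k i \<cdot> p_half k (i - 1)
       - s_gen k i \<cdot> p_half k (i - 1) \<cdot> p_gen k i \<cdot> p_half k i \<cdot> s_gen k (i - 1) \<cdot> L_elt k (i - 1)
           \<cdot> p_half k (i - 1) \<cdot> s_gen k i)"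

lemma L_elt_in_partition_algebra: "i \<le> k \<Longrightarrow> L_elt k i \<in> partition_algebra k"
  and sigma_in_partition_algebra: "i \<le> k \<Longrightarrow> sigma k i \<in> partition_algebra k"
  by (induction k i and k i rule: L_elt_sigma.induct)
    (auto simp: Let_def intro!: in_partition_algebra)

lemma sigma_half_in_partition_algebra: "i < k \<Longrightarrow> sigma_half k i \<in> partition_algebra k"
  by (induction k i rule: sigma_half.induct)
    (auto simp: Let_def intro!: in_partition_algebra L_elt_in_partition_algebra)

end

theory Submission
  imports Defs
begin

text \<open>
  The partition algebra acts on tensor space: for \<open>z = n\<close>, an element of the algebra on \<open>k\<close>
  columns is a matrix whose rows and columns are indexed by the colourings of \<open>1, ..., k\<close> with
  \<open>n\<close> colours, and the entry of a diagram at \<open>(c, d)\<close> is \<open>1\<close> if its blocks are monochromatic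
  when the top row is coloured by \<open>c\<close> and the bottom row by \<open>d\<close>, and \<open>0\<close> otherwise. This entry is
  \<open>kernel_at\<close>. Products become matrix products (\<open>kernel_product\<close>), because a component in the
  middle row can be coloured in \<open>n\<close> ways, and the matrices for all \<open>n\<close> together determine the
  element (\<open>element_eqI_kernel\<close>). So it suffices to compare matrix entries; associativity of the
  product also comes for free. Multiplication by a generator only recolours or restricts \<open>c\<close> or \<open>d\<close>.
  
  The entries of all elements in question can be computed from those of \<open>L\<^sub>i\<close>. Write \<open>f\<^sub>i(a, b)\<close>
  for the entry of \<open>L\<^sub>i\<close> as a function of the colours \<open>a\<close> and \<open>b\<close> of the vertices \<open>i\<close> and \<open>i'\<close>,
  the two ports of \<open>L\<^sub>i\<close>, with the colours in the columns before \<open>i\<close> fixed. Then: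
  
    \<^item> \<open>f\<^sub>i\<close> is symmetric, i.e. \<open>L\<^sub>i\<close> is unchanged if \<open>i\<close> and \<open>i'\<close> are exchanged;
  
    \<^item> \<open>\<sigma>\<^sub>i\<^sub>+\<^sub>1\<close> is \<open>L\<^sub>i\<close> with its top port attached to a new block \<open>{i, (i+1)'}\<close> and its bottom port
      to \<open>{i', i+1}\<close>;
  
    \<^item> \<open>\<sigma>\<close> with index \<open>i + 1/2\<close> is \<open>L\<^sub>i\<close> with its top port attached to \<open>{i, i'}\<close> and its bottom port
      to \<open>{i+1, (i+1)'}\<close>.
  
  Both descriptions of \<open>\<sigma>\<close> follow by induction, since the five terms of either recursion become
  the five terms in which \<open>L\<^sub>i\<close> is expressed by \<open>L\<^sub>i\<^sub>-\<^sub>1\<close>; here the symmetry of \<open>f\<^sub>i\<^sub>-\<^sub>1\<close> enters. Given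
  the descriptions, multiplying by \<open>s\<^sub>i\<close> from the right exchanges \<open>i'\<close> and \<open>(i+1)'\<close> and yields
  \<open>\<sigma>\<^sub>i\<^sub>+\<^sub>1\<close> directly; multiplying from the left exchanges \<open>i\<close> and \<open>i+1\<close> and yields \<open>\<sigma>\<^sub>i\<^sub>+\<^sub>1\<close> with the
  two ports of \<open>L\<^sub>i\<close> exchanged, which is the same.
\<close>

section \<open>Colourings of a diagram\<close>

definition constant_on_blocks :: "'a set set \<Rightarrow> ('a \<Rightarrow> 'b) \<Rightarrow> bool" where
  "constant_on_blocks P f \<longleftrightarrow> (\<forall>B\<in>P. \<forall>u\<in>B. \<forall>v\<in>B. f u = f v)"

fun colour :: "(nat \<Rightarrow> nat) \<Rightarrow> (nat \<Rightarrow> nat) \<Rightarrow> (nat \<Rightarrow> nat) \<Rightarrow> vertex \<Rightarrow> nat" where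
  "colour c e d (Top m) = c m"
| "colour c e d (Mid m) = e m"
| "colour c e d (Bot m) = d m"

text \<open>
  A diagram has top and bottom vertices only; \<open>0\<close> is a default colour for the middle ones.
\<close>

definition compatible :: "diagram \<Rightarrow> (nat \<Rightarrow> nat) \<Rightarrow> (nat \<Rightarrow> nat) \<Rightarrow> bool" where
  "compatible \<rho> c d \<longleftrightarrow> constant_on_blocks \<rho> (colour c (\<lambda>_. 0) d)"

lemma diagram_blockD:
  assumes "\<rho> \<in> diagrams k" "B \<in> \<rho>" "v \<in> B"
  shows "v \<in> Top ` {1..k} \<union> Bot ` {1..k}"
  using assms unfolding diagrams_def partition_on_def by blast

lemma compatible_cong:
  assumes "\<rho> \<in> diagrams k" "\<And>j. j \<in> {1..k} \<Longrightarrow> c j = c' j" "\<And>j. j \<in> {1..k} \<Longrightarrow> d j = d' j"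
  shows "compatible \<rho> c d \<longleftrightarrow> compatible \<rho> c' d'"
proof -
  have "colour c (\<lambda>_. 0) d v = colour c' (\<lambda>_. 0) d' v" if "B \<in> \<rho>" "v \<in> B" for B v
    using diagram_blockD[OF assms(1) that] assms(2,3) by auto
  then show ?thesis
    unfolding compatible_def constant_on_blocks_def by metis
qed

lemma constant_on_blocks_stacked_blocks:
  assumes "\<rho>\<^sub>1 \<in> diagrams k" "\<rho>\<^sub>2 \<in> diagrams k"
  shows "constant_on_blocks (stacked_blocks \<rho>\<^sub>1 \<rho>\<^sub>2) (colour c e d) \<longleftrightarrow>
    compatible \<rho>\<^sub>1 c e \<and> compatible \<rho>\<^sub>2 e d"
proof -
  have upper: "colour c e d (to_upper v) = colour c (\<lambda>_. 0) e v" if "B \<in> \<rho>\<^sub>1" "v \<in> B" for B v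
    using diagram_blockD[OF assms(1) that] by auto
  have lower: "colour c e d (to_lower v) = colour e (\<lambda>_. 0) d v" if "B \<in> \<rho>\<^sub>2" "v \<in> B" for B v
    using diagram_blockD[OF assms(2) that] by auto
  show ?thesis
    unfolding stacked_blocks_def compatible_def constant_on_blocks_def ball_Un ball_simps
    using upper lower by auto
qed

lemma constant_on_blocks_stacked_components:
  "constant_on_blocks (stacked_components \<rho>\<^sub>1 \<rho>\<^sub>2) f \<longleftrightarrow>
   constant_on_blocks (stacked_blocks \<rho>\<^sub>1 \<rho>\<^sub>2) f"
proof
  assume L: "constant_on_blocks (stacked_components \<rho>\<^sub>1 \<rho>\<^sub>2) f"
  show "constant_on_blocks (stacked_blocks \<rho>\<^sub>1 \<rho>\<^sub>2) f"
    unfolding constant_on_blocks_def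
  proof (intro ballI)
    fix B u v assume B: "B \<in> stacked_blocks \<rho>\<^sub>1 \<rho>\<^sub>2" "u \<in> B" "v \<in> B"
    then have "(u, v) \<in> (stacked_graph \<rho>\<^sub>1 \<rho>\<^sub>2)\<^sup>*"
      by (auto simp: stacked_graph_def intro!: r_into_rtrancl)
    moreover have "(stacked_graph \<rho>\<^sub>1 \<rho>\<^sub>2)\<^sup>* `` {u} \<in> stacked_components \<rho>\<^sub>1 \<rho>\<^sub>2"
      using B by (auto simp: stacked_components_def intro!: quotientI)
    ultimately show "f u = f v"
      using L unfolding constant_on_blocks_def by blast
  qed
next
  assume R: "constant_on_blocks (stacked_blocks \<rho>\<^sub>1 \<rho>\<^sub>2) f"
  have path: "f u = f v" if "(u, v) \<in> (stacked_graph \<rho>\<^sub>1 \<rho>\<^sub>2)\<^sup>*" for u v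
    using that
    by (induction rule: rtrancl_induct)
      (use R in \<open>auto simp: stacked_graph_def constant_on_blocks_def\<close>)
  show "constant_on_blocks (stacked_components \<rho>\<^sub>1 \<rho>\<^sub>2) f"
    unfolding constant_on_blocks_def stacked_components_def
    by (auto elim!: quotientE dest!: path)
qed

text \<open>
  Colourings are total functions, so that they can be updated freely; the bound
  concerns the columns \<open>1, ..., k\<close>. Sums over colourings use the extensional representatives in
  \<open>{1..k} \<rightarrow>\<^sub>E {..<n}\<close>.
\<close>

definition colourings :: "nat \<Rightarrow> nat \<Rightarrow> (nat \<Rightarrow> nat) set" where
  "colourings n k = {c. \<forall>j\<in>{1..k}. c j < n}"

text \<open>
  A colouring of the two stacked diagrams is a colouring of the components. On a component that
  meets the top or bottom row the colour is forced by \<open>c\<close> and \<open>d\<close>, consistently exactly if the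
  composite diagram is compatible; each component inside the middle row has a free choice among
  \<open>n\<close> colours. This is where the parameter \<open>z\<close> is seen to act as the number of colours.
\<close>

lemma card_middle_colourings:
  assumes diag: "\<rho>\<^sub>1 \<in> diagrams k" "\<rho>\<^sub>2 \<in> diagrams k"
    and c: "c \<in> colourings n k" and d: "d \<in> colourings n k"
  shows "card {e \<in> {1..k} \<rightarrow>\<^sub>E {..<n}. compatible \<rho>\<^sub>1 c e \<and> compatible \<rho>\<^sub>2 e d} =
    (if compatible (compose \<rho>\<^sub>1 \<rho>\<^sub>2) c d then n ^ loops \<rho>\<^sub>1 \<rho>\<^sub>2 else 0)"
proof -
  define K where "K = stacked_components \<rho>\<^sub>1 \<rho>\<^sub>2"
  define E where "E = {e \<in> {1..k} \<rightarrow>\<^sub>E {..<n}. compatible \<rho>\<^sub>1 c e \<and> compatible \<rho>\<^sub>2 e d}"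
  define Z where "Z = {D \<in> K. D \<subseteq> range Mid}"
  have P: "partition_on (Top ` {1..k} \<union> Mid ` {1..k} \<union> Bot ` {1..k}) K"
    unfolding K_def stacked_vertices[OF diag, symmetric]
    by (rule partition_on_stacked_components)
  have "finite K"
    using finite_elements[OF _ P] by simp
  then have "finite Z" by (simp add: Z_def)
  have E_iff: "e \<in> E \<longleftrightarrow> e \<in> {1..k} \<rightarrow>\<^sub>E {..<n} \<and> constant_on_blocks K (colour c e d)" for e
    unfolding E_def K_def constant_on_blocks_stacked_components
      constant_on_blocks_stacked_blocks[OF diag] by simp
  have unchanged: "colour c e d v = colour c e' d v" if "v \<notin> range Mid" for e e' v
    using that by (cases v) auto
  show ?thesis
  proof (cases "compatible (compose \<rho>\<^sub>1 \<rho>\<^sub>2) c d")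
    case False
    have "compatible (compose \<rho>\<^sub>1 \<rho>\<^sub>2) c d" if "e \<in> E" for e
      unfolding compatible_def constant_on_blocks_def
    proof (intro ballI)
      fix B u v assume "B \<in> compose \<rho>\<^sub>1 \<rho>\<^sub>2" "u \<in> B" "v \<in> B"
      then obtain D where "D \<in> K" "u \<in> D - range Mid" "v \<in> D - range Mid"
        by (auto simp: compose_def K_def)
      with \<open>e \<in> E\<close> have "colour c e d u = colour c e d v"
        unfolding E_iff constant_on_blocks_def by blast
      then show "colour c (\<lambda>_. 0) d u = colour c (\<lambda>_. 0) d v"
        using unchanged[of u e "\<lambda>_. 0"] unchanged[of v e "\<lambda>_. 0"]
          \<open>u \<in> D - range Mid\<close> \<open>v \<in> D - range Mid\<close> by simp
    qed
    then have "E = {}" using False by blast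
    then show ?thesis using False unfolding E_def[symmetric] by simp
  next
    case True
    define comp where "comp v = (THE D. D \<in> K \<and> v \<in> D)" for v
    have comp: "comp v = D" if "D \<in> K" "v \<in> D" for v D
      unfolding comp_def using that disjointD[OF partition_onD2[OF P] _ \<open>D \<in> K\<close>]
      by (intro the_equality) blast+
    define outer where "outer D = (SOME v. v \<in> D - range Mid)" for D :: "vertex set"
    define inner where "inner D = (SOME m. Mid m \<in> D)" for D
    have outer: "outer D \<in> D - range Mid" if "\<not> D \<subseteq> range Mid" for D
      unfolding outer_def using that by (metis DiffI someI_ex subsetI)
    have inner: "Mid (inner D) \<in> D" if "D \<in> Z" for D
    proof -
      have "D \<noteq> {}" using that partition_onD3[OF P] by (auto simp: Z_def)
      then show ?thesis
        unfolding inner_def using that by (intro someI_ex[of "\<lambda>m. Mid m \<in> D"]) (auto simp: Z_def)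
    qed
    have vertexD: "v \<in> Top ` {1..k} \<union> Mid ` {1..k} \<union> Bot ` {1..k}" if "D \<in> K" "v \<in> D" for D v
      using that unfolding partition_onD1[OF P] by blast
    \<comment> \<open>The colour of a component that a choice \<open>g\<close> of colours for the inner components leads to.\<close>
    define hue where "hue g D = (if D \<subseteq> range Mid then g D else colour c (\<lambda>_. 0) d (outer D))"
      for g :: "vertex set \<Rightarrow> nat" and D
    define extend where "extend g = (\<lambda>m\<in>{1..k}. hue g (comp (Mid m)))" for g
    define restr where "restr e = (\<lambda>D\<in>Z. e (inner D))" for e :: "nat \<Rightarrow> nat"
    have comp_Mid: "comp (Mid m) \<in> K \<and> Mid m \<in> comp (Mid m)" if "m \<in> {1..k}" for m
    proof -
      have "Mid m \<in> \<Union>K" using that unfolding partition_onD1[OF P, symmetric] by blast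
      then show ?thesis using comp by blast
    qed
    have hue: "hue g D < n" if "D \<in> K" "g \<in> Z \<rightarrow>\<^sub>E {..<n}" for g D
    proof (cases "D \<subseteq> range Mid")
      case True
      then show ?thesis using that by (auto simp: hue_def Z_def)
    next
      case False
      from outer[OF False] vertexD[OF that(1), of "outer D"]
      have "outer D \<in> Top ` {1..k} \<union> Bot ` {1..k}" by blast
      then have "colour c (\<lambda>_. 0) d (outer D) < n"
        using c d unfolding colourings_def by auto
      then show ?thesis using False by (simp add: hue_def)
    qed
    have "bij_betw extend (Z \<rightarrow>\<^sub>E {..<n}) E"
    proof (rule bij_betw_byWitness[where f' = restr])
      show "\<forall>g\<in>Z \<rightarrow>\<^sub>E {..<n}. restr (extend g) = g"
      proof (intro ballI extensionalityI[where A = Z])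
        fix g D assume g: "g \<in> Z \<rightarrow>\<^sub>E {..<n}" and D: "D \<in> Z"
        then have "D \<in> K" "D \<subseteq> range Mid" by (auto simp: Z_def)
        moreover have "inner D \<in> {1..k}"
          using vertexD[OF \<open>D \<in> K\<close> inner[OF D]] by auto
        ultimately show "restr (extend g) D = g D"
          using D comp[OF _ inner[OF D]] by (simp add: restr_def extend_def hue_def)
      qed (auto simp: restr_def PiE_def)
    next
      show "\<forall>e\<in>E. extend (restr e) = e"
      proof
        fix e assume "e \<in> E"
        then have e: "e \<in> {1..k} \<rightarrow>\<^sub>E {..<n}" "constant_on_blocks K (colour c e d)"
          by (auto simp: E_iff)
        show "extend (restr e) = e"
        proof
          fix m
          show "extend (restr e) m = e m"
          proof (cases "m \<in> {1..k}")
            case False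
            then show ?thesis using e(1) unfolding extend_def by (auto simp: PiE_def extensional_def)
          next
            case True
            define D where "D = comp (Mid m)"
            have D: "D \<in> K" "Mid m \<in> D" using comp_Mid[OF True] by (auto simp: D_def)
            have const: "colour c e d v = e m" if "v \<in> D" for v
              using e(2) that D unfolding constant_on_blocks_def
              by (metis colour.simps(2))
            have "hue (restr e) D = e m"
            proof (cases "D \<subseteq> range Mid")
              case True
              then have "D \<in> Z" using D by (simp add: Z_def)
              then show ?thesis
                using True const[OF inner] by (simp add: hue_def restr_def)
            next
              case False
              then show ?thesis
                using const[of "outer D"] outer[OF False] unchanged[of "outer D" "\<lambda>_. 0" e]
                by (simp add: hue_def)
            qed
            then show ?thesis using True by (simp add: extend_def D_def)
          qed
        qed
      qed
    next
      show "extend ` (Z \<rightarrow>\<^sub>E {..<n}) \<subseteq> E"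
      proof
        fix e assume "e \<in> extend ` (Z \<rightarrow>\<^sub>E {..<n})"
        then obtain g where g: "g \<in> Z \<rightarrow>\<^sub>E {..<n}" and e: "e = extend g" by blast
        have "e \<in> {1..k} \<rightarrow>\<^sub>E {..<n}"
          unfolding e extend_def using hue[OF _ g] comp_Mid by auto
        moreover have "colour c e d v = hue g D" if D: "D \<in> K" "v \<in> D" for D v
        proof (cases "v \<in> range Mid")
          case True
          then obtain m where m: "v = Mid m" "m \<in> {1..k}"
            using vertexD[OF D] by auto
          then show ?thesis using comp[OF D] by (simp add: e extend_def)
        next
          case False
          then have nD: "\<not> D \<subseteq> range Mid" using D by blast
          then have "D - range Mid \<in> compose \<rho>\<^sub>1 \<rho>\<^sub>2"
            using D by (auto simp: compose_def K_def)
          then have "colour c (\<lambda>_. 0) d v = colour c (\<lambda>_. 0) d (outer D)"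
            using True False D outer[OF nD]
            unfolding compatible_def constant_on_blocks_def by blast
          then show ?thesis using nD unchanged[OF False, of e "\<lambda>_. 0"] by (simp add: hue_def)
        qed
        ultimately show "e \<in> E"
          unfolding E_iff constant_on_blocks_def by metis
      qed
    next
      show "restr ` E \<subseteq> Z \<rightarrow>\<^sub>E {..<n}"
      proof
        fix g assume "g \<in> restr ` E"
        then obtain e where e: "e \<in> {1..k} \<rightarrow>\<^sub>E {..<n}" "g = restr e"
          by (auto simp: E_iff)
        have "inner D \<in> {1..k}" if "D \<in> Z" for D
          using vertexD[OF _ inner[OF that]] that by (auto simp: Z_def)
        then show "g \<in> Z \<rightarrow>\<^sub>E {..<n}" using e unfolding restr_def by (auto dest!: PiE_mem)
      qed
    qed
    then have "card E = card (Z \<rightarrow>\<^sub>E {..<n})"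
      by (simp add: bij_betw_same_card)
    also have "\<dots> = n ^ loops \<rho>\<^sub>1 \<rho>\<^sub>2"
      using \<open>finite Z\<close> by (simp add: card_PiE loops_def Z_def K_def)
    finally show ?thesis using True unfolding E_def[symmetric] by simp
  qed
qed

section \<open>The kernel of an element\<close>

definition kernel_at :: "nat \<Rightarrow> element \<Rightarrow> (nat \<Rightarrow> nat) \<Rightarrow> (nat \<Rightarrow> nat) \<Rightarrow> int" where
  "kernel_at n x c d =
     (\<Sum>\<rho>\<in>Poly_Mapping.keys x. poly (Poly_Mapping.lookup x \<rho>) (int n) * of_bool (compatible \<rho> c d))"

lemma kernel_superset:
  assumes "finite A" "Poly_Mapping.keys x \<subseteq> A"
  shows "kernel_at n x c d =
    (\<Sum>\<rho>\<in>A. poly (Poly_Mapping.lookup x \<rho>) (int n) * of_bool (compatible \<rho> c d))"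
  unfolding kernel_at_def using assms
  by (intro sum.mono_neutral_left) (auto simp: in_keys_iff)

lemma kernel_zero [simp]: "kernel_at n 0 c d = 0"
  by (simp add: kernel_at_def)

lemma kernel_add [simp]: "kernel_at n (x + y) c d = kernel_at n x c d + kernel_at n y c d"
proof -
  let ?A = "Poly_Mapping.keys x \<union> Poly_Mapping.keys y"
  have "Poly_Mapping.keys (x + y) \<subseteq> ?A" by (rule Poly_Mapping.keys_add)
  then show ?thesis
    by (simp add: kernel_superset[of ?A] lookup_add sum.distrib distrib_right)
qed

lemma kernel_uminus [simp]: "kernel_at n (- x) c d = - kernel_at n x c d"
  by (simp add: kernel_at_def sum_negf)

lemma kernel_diff [simp]: "kernel_at n (x - y) c d = kernel_at n x c d - kernel_at n y c d"
  using kernel_add[of n x "- y" c d] by simp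

lemma kernel_sum: "kernel_at n (sum f A) c d = (\<Sum>a\<in>A. kernel_at n (f a) c d)"
  by (induction A rule: infinite_finite_induct) auto

lemma kernel_single:
  "kernel_at n (Poly_Mapping.single \<rho> p) c d = poly p (int n) * of_bool (compatible \<rho> c d)"
  by (simp add: kernel_superset[of "{\<rho>}"])

lemma kernel_cong:
  assumes "x \<in> partition_algebra k" "\<And>j. j \<in> {1..k} \<Longrightarrow> c j = c' j" "\<And>j. j \<in> {1..k} \<Longrightarrow> d j = d' j"
  shows "kernel_at n x c d = kernel_at n x c' d'"
  unfolding kernel_at_def
proof (intro sum.cong refl)
  fix \<rho> assume "\<rho> \<in> Poly_Mapping.keys x"
  then have "\<rho> \<in> diagrams k" using assms(1) by (auto simp: partition_algebra_def)
  from compatible_cong[OF this assms(2,3)]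
  show "poly (Poly_Mapping.lookup x \<rho>) (int n) * of_bool (compatible \<rho> c d) =
      poly (Poly_Mapping.lookup x \<rho>) (int n) * of_bool (compatible \<rho> c' d')"
    by simp
qed

lemma kernel_product:
  assumes x: "x \<in> partition_algebra k" and y: "y \<in> partition_algebra k"
    and c: "c \<in> colourings n k" and d: "d \<in> colourings n k"
  shows "kernel_at n (x \<cdot> y) c d = (\<Sum>e\<in>{1..k} \<rightarrow>\<^sub>E {..<n}. kernel_at n x c e * kernel_at n y e d)"
proof -
  let ?E = "{1..k} \<rightarrow>\<^sub>E {..<n}"
  let ?X = "Poly_Mapping.keys x" and ?Y = "Poly_Mapping.keys y"
  let ?x = "\<lambda>\<rho>. poly (Poly_Mapping.lookup x \<rho>) (int n)"
  let ?y = "\<lambda>\<rho>. poly (Poly_Mapping.lookup y \<rho>) (int n)"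
  have fin: "finite ?E" by (intro finite_PiE) auto
  have count: "int n ^ loops \<rho>\<^sub>1 \<rho>\<^sub>2 * of_bool (compatible (compose \<rho>\<^sub>1 \<rho>\<^sub>2) c d) =
      (\<Sum>e\<in>?E. of_bool (compatible \<rho>\<^sub>1 c e) * of_bool (compatible \<rho>\<^sub>2 e d))"
    if "\<rho>\<^sub>1 \<in> ?X" "\<rho>\<^sub>2 \<in> ?Y" for \<rho>\<^sub>1 \<rho>\<^sub>2
  proof -
    have "\<rho>\<^sub>1 \<in> diagrams k" "\<rho>\<^sub>2 \<in> diagrams k"
      using x y that by (auto simp: partition_algebra_def)
    from card_middle_colourings[OF this c d]
    have "int n ^ loops \<rho>\<^sub>1 \<rho>\<^sub>2 * of_bool (compatible (compose \<rho>\<^sub>1 \<rho>\<^sub>2) c d) =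
        int (card {e \<in> ?E. compatible \<rho>\<^sub>1 c e \<and> compatible \<rho>\<^sub>2 e d})"
      by simp
    also have "\<dots> = (\<Sum>e\<in>?E. of_bool (compatible \<rho>\<^sub>1 c e \<and> compatible \<rho>\<^sub>2 e d))"
      using fin by (simp add: Collect_conj_eq)
    finally show ?thesis by (simp add: of_bool_conj)
  qed
  have "kernel_at n (x \<cdot> y) c d = (\<Sum>\<rho>\<^sub>1\<in>?X. \<Sum>\<rho>\<^sub>2\<in>?Y. ?x \<rho>\<^sub>1 * ?y \<rho>\<^sub>2 *
      (int n ^ loops \<rho>\<^sub>1 \<rho>\<^sub>2 * of_bool (compatible (compose \<rho>\<^sub>1 \<rho>\<^sub>2) c d)))"
    unfolding product_def kernel_sum kernel_single by (simp add: poly_monom mult_ac)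
  also have "\<dots> = (\<Sum>\<rho>\<^sub>1\<in>?X. \<Sum>\<rho>\<^sub>2\<in>?Y. \<Sum>e\<in>?E.
      (?x \<rho>\<^sub>1 * of_bool (compatible \<rho>\<^sub>1 c e)) * (?y \<rho>\<^sub>2 * of_bool (compatible \<rho>\<^sub>2 e d)))"
    using count by (intro sum.cong refl) (simp add: sum_distrib_left mult_ac)
  also have "\<dots> = (\<Sum>\<rho>\<^sub>1\<in>?X. \<Sum>e\<in>?E. \<Sum>\<rho>\<^sub>2\<in>?Y.
      (?x \<rho>\<^sub>1 * of_bool (compatible \<rho>\<^sub>1 c e)) * (?y \<rho>\<^sub>2 * of_bool (compatible \<rho>\<^sub>2 e d)))"
    by (intro sum.cong refl sum.swap)
  also have "\<dots> = (\<Sum>e\<in>?E. \<Sum>\<rho>\<^sub>1\<in>?X. \<Sum>\<rho>\<^sub>2\<in>?Y.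
      (?x \<rho>\<^sub>1 * of_bool (compatible \<rho>\<^sub>1 c e)) * (?y \<rho>\<^sub>2 * of_bool (compatible \<rho>\<^sub>2 e d)))"
    by (rule sum.swap)
  also have "\<dots> = (\<Sum>e\<in>?E. kernel_at n x c e * kernel_at n y e d)"
    by (simp only: kernel_at_def sum_product)
  finally show ?thesis .
qed

definition same_block :: "'a set set \<Rightarrow> ('a \<times> 'a) set" where
  "same_block P = (\<Union>B\<in>P. B \<times> B)"

lemma partition_eqI_same_block:
  assumes "partition_on A P" "partition_on A Q" "same_block P = same_block Q"
  shows "P = Q"
proof -
  have "A // same_block R = R" if "partition_on A R" for R
  proof -
    have "same_block R = {(u, v). \<exists>B\<in>R. u \<in> B \<and> v \<in> B}"
      by (auto simp: same_block_def)
    then show ?thesis using partition_on_eq_quotient[OF that] by simp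
  qed
  then show ?thesis using assms by metis
qed

text \<open>
  The action on tensor space is faithful if there are enough colours. Take a diagram \<open>\<pi>\<close> that is
  finest among those occurring in \<open>x\<close>, and give different colours to different blocks of \<open>\<pi>\<close>. The
  diagrams compatible with this colouring are the refinements of \<open>\<pi>\<close>, so among those in \<open>x\<close> only
  \<open>\<pi>\<close> itself survives, and the entry is the value at \<open>n\<close> of the coefficient of \<open>\<pi>\<close>. This
  coefficient therefore vanishes at all large \<open>n\<close>, hence it is the zero polynomial.
\<close>

lemma kernel_zero_imp_zero:
  assumes x: "x \<in> partition_algebra k"
    and zero: "\<And>n c d. c \<in> colourings n k \<Longrightarrow> d \<in> colourings n k \<Longrightarrow> kernel_at n x c d = 0"
  shows "x = 0"
proof (rule ccontr)
  assume "x \<noteq> 0"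
  let ?X = "Poly_Mapping.keys x" and ?V = "Top ` {1..k} \<union> Bot ` {1..k}"
  have part: "partition_on ?V \<rho>" if "\<rho> \<in> ?X" for \<rho>
    using x that by (auto simp: partition_algebra_def diagrams_def)
  have "same_block ` ?X \<noteq> {}" using \<open>x \<noteq> 0\<close> by simp
  then obtain \<pi> where \<pi>: "\<pi> \<in> ?X"
    and min: "\<And>\<rho>. \<rho> \<in> ?X \<Longrightarrow> same_block \<rho> \<subseteq> same_block \<pi> \<Longrightarrow> same_block \<rho> = same_block \<pi>"
    using finite_has_minimal[of "same_block ` ?X"] by auto
  note P = part[OF \<pi>]
  have "finite \<pi>" using finite_elements[OF _ P] by simp
  then obtain g :: "vertex set \<Rightarrow> nat" where g: "bij_betw g \<pi> {0..<card \<pi>}"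
    using ex_bij_betw_finite_nat by blast
  define f where "f v = g (THE B. B \<in> \<pi> \<and> v \<in> B)" for v
  have f: "f v = g B" if "B \<in> \<pi>" "v \<in> B" for v B
  proof -
    have "(THE B. B \<in> \<pi> \<and> v \<in> B) = B"
      using that disjointD[OF partition_onD2[OF P] _ \<open>B \<in> \<pi>\<close>] by (intro the_equality) blast+
    then show ?thesis by (simp add: f_def)
  qed
  have f_eq_iff: "f u = f v \<longleftrightarrow> (u, v) \<in> same_block \<pi>" if uv: "u \<in> ?V" "v \<in> ?V" for u v
  proof -
    from uv obtain B C where BC: "B \<in> \<pi>" "u \<in> B" "C \<in> \<pi>" "v \<in> C"
      unfolding partition_onD1[OF P] by blast
    then have "f u = f v \<longleftrightarrow> B = C"
      using f bij_betw_imp_inj_on[OF g] by (metis inj_onD)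
    also have "\<dots> \<longleftrightarrow> (u, v) \<in> same_block \<pi>"
      using BC disjointD[OF partition_onD2[OF P]] unfolding same_block_def by blast
    finally show ?thesis .
  qed
  define c where "c m = f (Top m)" for m
  define d where "d m = f (Bot m)" for m
  have compat: "compatible \<rho> c d \<longleftrightarrow> \<rho> = \<pi>" if \<rho>: "\<rho> \<in> ?X" for \<rho>
  proof -
    have V: "\<Union>\<rho> = ?V" using partition_onD1[OF part[OF \<rho>]] by simp
    have "colour c (\<lambda>_. 0) d v = f v" if "B \<in> \<rho>" "v \<in> B" for B v
    proof -
      have "v \<in> ?V" using that unfolding V[symmetric] by blast
      then show ?thesis by (auto simp: c_def d_def)
    qed
    then have "compatible \<rho> c d \<longleftrightarrow> (\<forall>B\<in>\<rho>. \<forall>u\<in>B. \<forall>v\<in>B. f u = f v)"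
      unfolding compatible_def constant_on_blocks_def by (intro ball_cong refl) simp
    also have "\<dots> \<longleftrightarrow> same_block \<rho> \<subseteq> same_block \<pi>"
    proof -
      have "f u = f v \<longleftrightarrow> (u, v) \<in> same_block \<pi>" if "B \<in> \<rho>" "u \<in> B" "v \<in> B" for B u v
        using that V by (intro f_eq_iff) blast+
      then show ?thesis unfolding same_block_def[of \<rho>] by blast
    qed
    also have "\<dots> \<longleftrightarrow> \<rho> = \<pi>"
      using min[OF \<rho>] partition_eqI_same_block[OF part[OF \<rho>] P] by blast
    finally show ?thesis .
  qed
  have "poly (Poly_Mapping.lookup x \<pi>) (int n) = 0" if n: "n \<ge> card \<pi>" for n
  proof -
    have "f v < n" if v: "v \<in> ?V" for v
    proof -
      from v obtain B where B: "B \<in> \<pi>" "v \<in> B" unfolding partition_onD1[OF P] by blast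
      then have "g B \<in> {0..<card \<pi>}" using bij_betwE[OF g] by blast
      then show ?thesis using f[OF B] n by simp
    qed
    then have "c \<in> colourings n k" "d \<in> colourings n k"
      by (auto simp: colourings_def c_def d_def)
    then have "0 = kernel_at n x c d" by (simp add: zero)
    also have "\<dots> = (\<Sum>\<rho>\<in>?X. if \<rho> = \<pi> then poly (Poly_Mapping.lookup x \<pi>) (int n) else 0)"
      unfolding kernel_at_def
    proof (intro sum.cong refl)
      fix \<rho> assume "\<rho> \<in> ?X"
      then show "poly (Poly_Mapping.lookup x \<rho>) (int n) * of_bool (compatible \<rho> c d) =
          (if \<rho> = \<pi> then poly (Poly_Mapping.lookup x \<pi>) (int n) else 0)"
        unfolding compat[OF \<open>\<rho> \<in> ?X\<close>] by simp
    qed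
    also have "\<dots> = poly (Poly_Mapping.lookup x \<pi>) (int n)"
      using \<pi> by simp
    finally show ?thesis by simp
  qed
  then have "int ` {card \<pi>..} \<subseteq> {z. poly (Poly_Mapping.lookup x \<pi>) z = 0}" by auto
  moreover have "infinite (int ` {card \<pi>..})"
    by (simp add: finite_image_iff infinite_Ici)
  ultimately have "Poly_Mapping.lookup x \<pi> = 0"
    using poly_roots_finite finite_subset by blast
  with \<pi> show False by (simp add: in_keys_iff)
qed

lemma element_eqI_kernel:
  assumes "x \<in> partition_algebra k" "y \<in> partition_algebra k"
    and "\<And>n c d. c \<in> colourings n k \<Longrightarrow> d \<in> colourings n k \<Longrightarrow> kernel_at n x c d = kernel_at n y c d"
  shows "x = y"
  using kernel_zero_imp_zero[of "x - y" k] assms by (simp add: in_partition_algebra_diff)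

text \<open>
  Matrix multiplication is associative and the matrices determine the element.
\<close>

lemma product_assoc:
  assumes "x \<in> partition_algebra k" "y \<in> partition_algebra k" "z \<in> partition_algebra k"
  shows "x \<cdot> y \<cdot> z = x \<cdot> (y \<cdot> z)"
proof (rule element_eqI_kernel)
  fix n c d assume cd: "c \<in> colourings n k" "d \<in> colourings n k"
  let ?E = "{1..k} \<rightarrow>\<^sub>E {..<n}"
  have E: "e \<in> colourings n k" if "e \<in> ?E" for e
    using that by (auto simp: colourings_def)
  have "kernel_at n (x \<cdot> y \<cdot> z) c d =
      (\<Sum>e\<in>?E. \<Sum>e'\<in>?E. kernel_at n x c e' * kernel_at n y e' e * kernel_at n z e d)"
    using assms cd E
    by (simp add: kernel_product[where k = k] in_partition_algebra_product sum_distrib_right)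
  also have "\<dots> = (\<Sum>e'\<in>?E. \<Sum>e\<in>?E. kernel_at n x c e' * kernel_at n y e' e * kernel_at n z e d)"
    by (rule sum.swap)
  also have "\<dots> = kernel_at n (x \<cdot> (y \<cdot> z)) c d"
    using assms cd E
    by (simp add: kernel_product[where k = k] in_partition_algebra_product sum_distrib_left mult.assoc)
  finally show "kernel_at n (x \<cdot> y \<cdot> z) c d = kernel_at n (x \<cdot> (y \<cdot> z)) c d" .
qed (use assms in_partition_algebra_product in auto)

section \<open>Multiplication by the generators\<close>

lemma compatible_Un_verticals:
  "compatible (P \<union> verticals M) c d \<longleftrightarrow> compatible P c d \<and> (\<forall>m\<in>M. c m = d m)"
  unfolding compatible_def constant_on_blocks_def verticals_def Setcompr_eq_image ball_Un
  by (simp add: ball_simps eq_commute conj_commute)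

lemma colouringsD: "c \<in> colourings n k \<Longrightarrow> 1 \<le> j \<Longrightarrow> j \<le> k \<Longrightarrow> c j < n"
  by (simp add: colourings_def)

lemma colourings_upd: "c \<in> colourings n k \<Longrightarrow> a < n \<Longrightarrow> c(j := a) \<in> colourings n k"
  by (simp add: colourings_def)

text \<open>
  In the rows of the matrices of the generators, at most one entry (for \<open>s_gen\<close> and \<open>p_half\<close>), or
  one entry for each colour (for \<open>p_gen\<close>), is nonzero; this lemma evaluates the product with such
  a row or column.
\<close>

lemma sum_pick_colouring:
  fixes f :: "(nat \<Rightarrow> nat) \<Rightarrow> int"
  assumes c: "c \<in> colourings n k"
    and cong: "\<And>e. (\<And>j. j \<in> {1..k} \<Longrightarrow> e j = c j) \<Longrightarrow> f e = f c"
  shows "(\<Sum>e\<in>{1..k} \<rightarrow>\<^sub>E {..<n}. of_bool (\<forall>j\<in>{1..k}. e j = c j) * f e) = f c"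
proof -
  let ?E = "{1..k} \<rightarrow>\<^sub>E {..<n}"
  have r: "restrict c {1..k} \<in> ?E" using c by (auto simp: colourings_def)
  have fin: "finite ?E" by (intro finite_PiE) auto
  have unique: "(\<forall>j\<in>{1..k}. e j = c j) \<longleftrightarrow> e = restrict c {1..k}" if "e \<in> ?E" for e
    using that by (auto simp: PiE_def intro: extensionalityI)
  have "(\<Sum>e\<in>?E. of_bool (\<forall>j\<in>{1..k}. e j = c j) * f e) =
      (\<Sum>e\<in>?E. if e = restrict c {1..k} then f e else 0)"
    by (intro sum.cong refl) (simp only: unique of_bool_def, simp)
  also have "\<dots> = f (restrict c {1..k})"
    using r fin by simp
  also have "\<dots> = f c" by (rule cong) simp
  finally show ?thesis .
qed

lemma kernel_at_basis: "kernel_at n (basis \<rho>) c d = of_bool (compatible \<rho> c d)"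
  by (simp add: basis_def kernel_single)

lemma kernel_at_unit: "kernel_at n (unit_elt k) c d = of_bool (\<forall>j\<in>{1..k}. c j = d j)"
  using compatible_Un_verticals[of "{}" "{1..k}" c d]
  by (simp add: unit_elt_def kernel_at_basis compatible_def constant_on_blocks_def)

lemma ball_columns:
  assumes "1 \<le> i" "i < k"
  shows "(\<forall>j\<in>{1..k}. Q j) \<longleftrightarrow> Q i \<and> Q (Suc i) \<and> (\<forall>j\<in>{1..k} - {i, i + 1}. Q j)"
proof -
  have "(\<forall>j\<in>{1..k}. Q j) \<longleftrightarrow> (\<forall>j\<in>insert i (insert (Suc i) ({1..k} - {i, i + 1})). Q j)"
    using assms by (intro ball_cong) auto
  then show ?thesis by (simp only: ball_simps)
qed

text \<open>
  The kernels of the generators are written twice, once with the bottom and once with the top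
  colouring determined by the other one: the first form is used for multiplication from the left
  and the second for multiplication from the right.
\<close>

lemma kernel_at_s_gen:
  assumes "1 \<le> i" "i < k"
  shows "kernel_at n (s_gen k i) c d = of_bool (\<forall>j\<in>{1..k}. d j = (c(i := c (Suc i), Suc i := c i)) j)"
    and "kernel_at n (s_gen k i) c d = of_bool (\<forall>j\<in>{1..k}. c j = (d(i := d (Suc i), Suc i := d i)) j)"
    and "kernel_at n (s_gen k i) c d =
      of_bool ((c i = d (Suc i) \<and> c (Suc i) = d i) \<and> (\<forall>m\<in>{1..k} - {i, i + 1}. c m = d m))"
proof -
  have *: "compatible {{Top i, Bot (i + 1)}, {Top (i + 1), Bot i}} c d \<longleftrightarrow>
      c i = d (Suc i) \<and> c (Suc i) = d i"
    by (auto simp: compatible_def constant_on_blocks_def)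
  show "kernel_at n (s_gen k i) c d =
      of_bool ((c i = d (Suc i) \<and> c (Suc i) = d i) \<and> (\<forall>m\<in>{1..k} - {i, i + 1}. c m = d m))"
    unfolding s_gen_def kernel_at_basis compatible_Un_verticals * ..
  show "kernel_at n (s_gen k i) c d = of_bool (\<forall>j\<in>{1..k}. d j = (c(i := c (Suc i), Suc i := c i)) j)"
    and "kernel_at n (s_gen k i) c d = of_bool (\<forall>j\<in>{1..k}. c j = (d(i := d (Suc i), Suc i := d i)) j)"
    unfolding s_gen_def kernel_at_basis compatible_Un_verticals * ball_columns[OF assms]
    by (auto intro!: arg_cong[where f = of_bool] simp: eq_commute[of "d _" "c _"])
qed

lemma kernel_at_p_half:
  assumes "1 \<le> i" "i < k"
  shows "kernel_at n (p_half k i) c d =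
    of_bool (c i = c (Suc i)) * of_bool (\<forall>j\<in>{1..k}. d j = c j)"
    and "kernel_at n (p_half k i) c d =
    of_bool (d i = d (Suc i)) * of_bool (\<forall>j\<in>{1..k}. c j = d j)"
proof -
  have *: "compatible {{Top i, Top (i + 1), Bot i, Bot (i + 1)}} c d \<longleftrightarrow>
      c i = c (Suc i) \<and> d i = c i \<and> d (Suc i) = c i"
    by (auto simp: compatible_def constant_on_blocks_def)
  show "kernel_at n (p_half k i) c d =
    of_bool (c i = c (Suc i)) * of_bool (\<forall>j\<in>{1..k}. d j = c j)"
    and "kernel_at n (p_half k i) c d =
    of_bool (d i = d (Suc i)) * of_bool (\<forall>j\<in>{1..k}. c j = d j)"
    unfolding p_half_def kernel_at_basis compatible_Un_verticals * ball_columns[OF assms]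
      of_bool_conj[symmetric]
    by (auto intro!: arg_cong[where f = of_bool] simp: eq_commute[of "d _" "c _"])
qed

lemma kernel_at_p_gen:
  assumes "1 \<le> j" "j \<le> k"
  shows "d \<in> colourings n k \<Longrightarrow>
      kernel_at n (p_gen k j) c d = (\<Sum>a<n. of_bool (\<forall>m\<in>{1..k}. d m = (c(j := a)) m))"
    and "c \<in> colourings n k \<Longrightarrow>
      kernel_at n (p_gen k j) c d = (\<Sum>a<n. of_bool (\<forall>m\<in>{1..k}. c m = (d(j := a)) m))"
    and "kernel_at n (p_gen k j) c d = of_bool (\<forall>m\<in>{1..k} - {j}. c m = d m)"
proof -
  have *: "compatible {{Top j}, {Bot j}} c d"
    by (auto simp: compatible_def constant_on_blocks_def)
  show p: "kernel_at n (p_gen k j) c d = of_bool (\<forall>m\<in>{1..k} - {j}. c m = d m)"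
    unfolding p_gen_def kernel_at_basis compatible_Un_verticals using * by simp
  have sum: "(\<Sum>a<n. of_bool (\<forall>m\<in>{1..k}. e m = (e'(j := a)) m)) =
      (of_bool (\<forall>m\<in>{1..k} - {j}. e m = e' m) :: int)" (is "_ = of_bool ?Q")
    if "e \<in> colourings n k" for e e'
  proof -
    have "(\<forall>m\<in>{1..k}. e m = (e'(j := a)) m) \<longleftrightarrow> a = e j \<and> ?Q" for a
      using assms by auto
    then have "(\<Sum>a<n. of_bool (\<forall>m\<in>{1..k}. e m = (e'(j := a)) m)) =
        (\<Sum>a<n. if a = e j then of_bool ?Q else 0 :: int)"
      by (intro sum.cong refl) (simp only: of_bool_def, simp)
    then show ?thesis
      using colouringsD[OF that assms] by simp
  qed
  show "kernel_at n (p_gen k j) c d = (\<Sum>a<n. of_bool (\<forall>m\<in>{1..k}. d m = (c(j := a)) m))"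
    if "d \<in> colourings n k"
    unfolding p sum[OF that] by (simp only: eq_commute[of "d _" "c _"])
  show "kernel_at n (p_gen k j) c d = (\<Sum>a<n. of_bool (\<forall>m\<in>{1..k}. c m = (d(j := a)) m))"
    if "c \<in> colourings n k"
    unfolding p sum[OF that] ..
qed

context
  fixes x :: element and c d :: "nat \<Rightarrow> nat" and n k :: nat
  assumes x: "x \<in> partition_algebra k"
    and c: "c \<in> colourings n k" and d: "d \<in> colourings n k"
begin

lemma pick_left:
  "e \<in> colourings n k \<Longrightarrow>
   (\<Sum>e'\<in>{1..k} \<rightarrow>\<^sub>E {..<n}. of_bool (\<forall>j\<in>{1..k}. e' j = e j) * kernel_at n x e' d) = kernel_at n x e d"
  by (rule sum_pick_colouring) (auto intro: kernel_cong[OF x])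

lemma pick_right:
  "e \<in> colourings n k \<Longrightarrow>
   (\<Sum>e'\<in>{1..k} \<rightarrow>\<^sub>E {..<n}. of_bool (\<forall>j\<in>{1..k}. e' j = e j) * kernel_at n x c e') = kernel_at n x c e"
  by (rule sum_pick_colouring) (auto intro: kernel_cong[OF x])

lemma kernel_s_gen_product:
  assumes "1 \<le> i" "i < k"
  shows "kernel_at n (s_gen k i \<cdot> x) c d = kernel_at n x (c(i := c (Suc i), Suc i := c i)) d"
    and "kernel_at n (x \<cdot> s_gen k i) c d = kernel_at n x c (d(i := d (Suc i), Suc i := d i))"
proof -
  have "e(i := e (Suc i), Suc i := e i) \<in> colourings n k" if "e \<in> colourings n k" for e
    using that assms by (auto simp: colourings_def)
  note swap = this[OF c] this[OF d]
  note mem = s_gen_in_partition_algebra[OF assms]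
  show "kernel_at n (s_gen k i \<cdot> x) c d = kernel_at n x (c(i := c (Suc i), Suc i := c i)) d"
    unfolding kernel_product[OF mem x c d] kernel_at_s_gen(1)[OF assms] pick_left[OF swap(1)] ..
  show "kernel_at n (x \<cdot> s_gen k i) c d = kernel_at n x c (d(i := d (Suc i), Suc i := d i))"
    unfolding kernel_product[OF x mem c d] kernel_at_s_gen(2)[OF assms]
    using pick_right[OF swap(2)] by (simp add: mult.commute)
qed

lemma kernel_p_half_product:
  assumes "1 \<le> i" "i < k"
  shows "kernel_at n (p_half k i \<cdot> x) c d = (if c i = c (Suc i) then kernel_at n x c d else 0)"
    and "kernel_at n (x \<cdot> p_half k i) c d = (if d i = d (Suc i) then kernel_at n x c d else 0)"
proof -
  note mem = p_half_in_partition_algebra[OF assms]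
  show "kernel_at n (p_half k i \<cdot> x) c d = (if c i = c (Suc i) then kernel_at n x c d else 0)"
    unfolding kernel_product[OF mem x c d] kernel_at_p_half(1)[OF assms]
      mult.assoc sum_distrib_left[symmetric] pick_left[OF c] by simp
  show "kernel_at n (x \<cdot> p_half k i) c d = (if d i = d (Suc i) then kernel_at n x c d else 0)"
    unfolding kernel_product[OF x mem c d] kernel_at_p_half(2)[OF assms]
      mult.commute[of "kernel_at n x _ _"]
      mult.assoc sum_distrib_left[symmetric] pick_right[OF d] by simp
qed

lemma kernel_p_gen_product:
  assumes "1 \<le> j" "j \<le> k"
  shows "kernel_at n (p_gen k j \<cdot> x) c d = (\<Sum>a<n. kernel_at n x (c(j := a)) d)"
    and "kernel_at n (x \<cdot> p_gen k j) c d = (\<Sum>a<n. kernel_at n x c (d(j := a)))"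
proof -
  let ?E = "{1..k} \<rightarrow>\<^sub>E {..<n}"
  note mem = p_gen_in_partition_algebra[OF assms]
  have E: "e \<in> colourings n k" if "e \<in> ?E" for e
    using that by (auto simp: colourings_def)
  have "kernel_at n (p_gen k j \<cdot> x) c d =
      (\<Sum>e\<in>?E. \<Sum>a<n. of_bool (\<forall>m\<in>{1..k}. e m = (c(j := a)) m) * kernel_at n x e d)"
    unfolding kernel_product[OF mem x c d]
    by (intro sum.cong refl) (simp only: kernel_at_p_gen(1)[OF assms E] sum_distrib_right)
  also have "\<dots> = (\<Sum>a<n. \<Sum>e\<in>?E. of_bool (\<forall>m\<in>{1..k}. e m = (c(j := a)) m) * kernel_at n x e d)"
    by (rule sum.swap)
  also have "\<dots> = (\<Sum>a<n. kernel_at n x (c(j := a)) d)"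
    by (intro sum.cong refl pick_left colourings_upd[OF c]) simp
  finally show "kernel_at n (p_gen k j \<cdot> x) c d = (\<Sum>a<n. kernel_at n x (c(j := a)) d)" .
  have "kernel_at n (x \<cdot> p_gen k j) c d =
      (\<Sum>e\<in>?E. \<Sum>a<n. of_bool (\<forall>m\<in>{1..k}. e m = (d(j := a)) m) * kernel_at n x c e)"
    unfolding kernel_product[OF x mem c d]
    by (intro sum.cong refl)
      (simp only: kernel_at_p_gen(2)[OF assms E] mult.commute[of "kernel_at n x _ _"] sum_distrib_right)
  also have "\<dots> = (\<Sum>a<n. \<Sum>e\<in>?E. of_bool (\<forall>m\<in>{1..k}. e m = (d(j := a)) m) * kernel_at n x c e)"
    by (rule sum.swap)
  also have "\<dots> = (\<Sum>a<n. kernel_at n x c (d(j := a)))"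
    by (intro sum.cong refl pick_right colourings_upd[OF d]) simp
  finally show "kernel_at n (x \<cdot> p_gen k j) c d = (\<Sum>a<n. kernel_at n x c (d(j := a)))" .
qed

end

text \<open>
  Reading from the outside: the columns \<open>m\<close> and \<open>m + 1\<close> are joined, then column \<open>m + 1\<close> is cut and
  restarted, and its new part is joined to column \<open>m + 2\<close>. The sum over the colours of the new part
  thus has a single nonzero summand, in which column \<open>m + 1\<close> has the colour of column \<open>m + 2\<close>.
\<close>

lemma kernel_left_triple:
  assumes "x \<in> partition_algebra k" "c \<in> colourings n k" "d \<in> colourings n k" "1 \<le> m" "Suc m < k"
  shows "kernel_at n (p_half k m \<cdot> (p_gen k (Suc m) \<cdot> (p_half k (Suc m) \<cdot> x))) c d =
    (if c m = c (Suc m) then kernel_at n x (c(Suc m := c (Suc (Suc m)))) d else 0)"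
  using assms colouringsD[OF assms(2), of "Suc (Suc m)"]
  by (simp add: kernel_p_half_product[where k = k] kernel_p_gen_product[where k = k]
      in_partition_algebra colourings_upd)

lemma kernel_right_triple:
  assumes "x \<in> partition_algebra k" "c \<in> colourings n k" "d \<in> colourings n k" "1 \<le> m" "Suc m < k"
  shows "kernel_at n (x \<cdot> p_half k (Suc m) \<cdot> p_gen k (Suc m) \<cdot> p_half k m) c d =
    (if d m = d (Suc m) then kernel_at n x c (d(Suc m := d (Suc (Suc m)))) else 0)"
  using assms colouringsD[OF assms(3), of "Suc (Suc m)"]
  by (simp add: kernel_p_half_product[where k = k] kernel_p_gen_product[where k = k]
      in_partition_algebra colourings_upd)

section \<open>The kernels of the recursively defined elements\<close>

text \<open>
  The entry of \<open>L\<^sub>i\<close>, with the colours of \<open>c\<close> and \<open>d\<close> in the columns before \<open>i\<close>, and with the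
  colours \<open>a\<close> and \<open>b\<close> at the ports \<open>i\<close> and \<open>i'\<close>. The ports are separate arguments because \<open>L\<^sub>i\<^sub>+\<^sub>1\<close> and
  \<open>\<sigma>\<^sub>i\<^sub>+\<^sub>1\<close> attach them to vertices of other columns. In the recursive case, \<open>u\<close> and \<open>v\<close> are the colours of
  the vertices \<open>i\<close> and \<open>i'\<close>, and \<open>a\<close> and \<open>b\<close> those of \<open>i + 1\<close> and \<open>(i + 1)'\<close>. The five terms
  belong to those in the definition of \<open>L\<^sub>i\<^sub>+\<^sub>1\<close>, the last one being \<open>\<sigma>\<^sub>i\<^sub>+\<^sub>1\<close>. No loops are
  created in the course of the recursion, so these entries are the same for every number of colours.
\<close>

fun port_kernel :: "nat \<Rightarrow> (nat \<Rightarrow> nat) \<Rightarrow> (nat \<Rightarrow> nat) \<Rightarrow> nat \<Rightarrow> nat \<Rightarrow> int" where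
  "port_kernel 0 c d a b = 0"
| "port_kernel (Suc 0) c d a b = 1"
| "port_kernel (Suc (Suc m)) c d a b =
    (let i = Suc m; u = c i; v = d i in
       - (if u = v \<and> v = b then port_kernel i c d a v else 0)
       - (if u = a \<and> u = v then port_kernel i c d u b else 0)
       + (if u = a \<and> v = b then port_kernel i c d u v else 0)
       + (if u = v then port_kernel i c d a b else 0)
       + (if u = b \<and> a = v then port_kernel i c d u v else 0))"

lemma port_kernel_Suc:
  assumes "Suc 0 \<le> i"
  shows "port_kernel (Suc i) c d a b =
    - (if c i = d i \<and> d i = b then port_kernel i c d a (d i) else 0)
    - (if c i = a \<and> c i = d i then port_kernel i c d (c i) b else 0)
    + (if c i = a \<and> d i = b then port_kernel i c d (c i) (d i) else 0)
    + (if c i = d i then port_kernel i c d a b else 0)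
    + (if c i = b \<and> a = d i then port_kernel i c d (c i) (d i) else 0)"
  using assms by (cases i) (simp_all add: Let_def)

text \<open>
  The same expansion, with the terms as they arise from the recursions of \<open>sigma\<close> and
  \<open>sigma_half\<close>: the conjugate of the preceding \<open>sigma\<close> gives the term of \<open>s\<^sub>i L\<^sub>i s\<^sub>i\<close>, and the other four
  terms in turn give the remaining ones.
\<close>

lemma port_kernel_Suc_regrouped:
  assumes "Suc 0 \<le> i"
  shows "port_kernel (Suc i) c d a b =
      (if c i = d i then port_kernel i c d a b else 0)
    + (if c i = b \<and> d i = a then port_kernel i c d (c i) (d i) else 0)
    + (if c i = a \<and> d i = b then port_kernel i c d (c i) (d i) else 0)
    - (if c i = b \<and> c i = d i then port_kernel i c d a (c i) else 0)
    - (if c i = a \<and> c i = d i then port_kernel i c d (c i) b else 0)"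
proof -
  have "(if c i = b \<and> c i = d i then port_kernel i c d a (c i) else 0) =
      (if c i = d i \<and> d i = b then port_kernel i c d a (d i) else 0)"
    by simp
  moreover have "c i = b \<and> d i = a \<longleftrightarrow> c i = b \<and> a = d i"
    by (simp only: eq_commute)
  ultimately show ?thesis
    unfolding port_kernel_Suc[OF assms] by (simp only: algebra_simps)
qed

text \<open>
  Exchanging \<open>a\<close> and \<open>b\<close> interchanges the two negative terms, fixes the fourth term, and
  interchanges the third term with the last one, \<open>\<sigma>\<^sub>i\<^sub>+\<^sub>1\<close>. In the negative terms and the fourth one, the induction hypothesis
  exchanges the ports of \<open>L\<^sub>i\<close>.
\<close>

lemma port_kernel_sym: "port_kernel i c d a b = port_kernel i c d b a"
proof (induction i arbitrary: a b rule: induct_nat_012)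
  case (ge2 m)
  then show ?case by (auto simp: Let_def)
qed auto

lemma port_kernel_upd [simp]:
  assumes "i \<le> j"
  shows "port_kernel i (c(j := x)) d a b = port_kernel i c d a b"
    and "port_kernel i c (d(j := x)) a b = port_kernel i c d a b"
  using assms by (induction i arbitrary: a b rule: induct_nat_012) (auto simp: Let_def)

definition agree_beyond :: "nat \<Rightarrow> nat \<Rightarrow> (nat \<Rightarrow> nat) \<Rightarrow> (nat \<Rightarrow> nat) \<Rightarrow> bool" where
  "agree_beyond i k c d \<longleftrightarrow> (\<forall>j\<in>{i<..k}. c j = d j)"

lemma agree_beyond_upd [simp]:
  assumes "j \<le> i"
  shows "agree_beyond i k (c(j := x)) d \<longleftrightarrow> agree_beyond i k c d"
    and "agree_beyond i k c (d(j := x)) \<longleftrightarrow> agree_beyond i k c d"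
  using assms by (auto simp: agree_beyond_def)

lemma agree_beyond_Suc:
  assumes "i < k"
  shows "agree_beyond i k c d \<longleftrightarrow> c (Suc i) = d (Suc i) \<and> agree_beyond (Suc i) k c d"
proof -
  have "{i<..k} = insert (Suc i) {Suc i<..k}" using assms by auto
  then show ?thesis by (simp add: agree_beyond_def)
qed

text \<open>
  The three matrices that belong to \<open>L\<^sub>i\<close>, \<open>\<sigma>\<^sub>i\<^sub>+\<^sub>1\<close> and \<open>\<sigma>\<close> with index \<open>i + 1/2\<close>. On the columns in which
  \<open>agree_beyond\<close> is required, these elements are the identity.
\<close>

definition L_kernel :: "nat \<Rightarrow> nat \<Rightarrow> (nat \<Rightarrow> nat) \<Rightarrow> (nat \<Rightarrow> nat) \<Rightarrow> int" where
  "L_kernel k i c d = (if agree_beyond i k c d then port_kernel i c d (c i) (d i) else 0)"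

definition sigma_kernel :: "nat \<Rightarrow> nat \<Rightarrow> (nat \<Rightarrow> nat) \<Rightarrow> (nat \<Rightarrow> nat) \<Rightarrow> int" where
  "sigma_kernel k i c d =
    (if c i = d (Suc i) \<and> c (Suc i) = d i \<and> agree_beyond (Suc i) k c d
     then port_kernel i c d (c i) (d i) else 0)"

definition sigma_half_kernel :: "nat \<Rightarrow> nat \<Rightarrow> (nat \<Rightarrow> nat) \<Rightarrow> (nat \<Rightarrow> nat) \<Rightarrow> int" where
  "sigma_half_kernel k i c d =
    (if c i = d i \<and> c (Suc i) = d (Suc i) \<and> agree_beyond (Suc i) k c d
     then port_kernel i c d (c i) (c (Suc i)) else 0)"

definition has_kernel :: "nat \<Rightarrow> element \<Rightarrow> ((nat \<Rightarrow> nat) \<Rightarrow> (nat \<Rightarrow> nat) \<Rightarrow> int) \<Rightarrow> bool" where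
  "has_kernel k x f \<longleftrightarrow> (\<forall>n. \<forall>c\<in>colourings n k. \<forall>d\<in>colourings n k. kernel_at n x c d = f c d)"

lemma has_kernelD:
  "has_kernel k x f \<Longrightarrow> c \<in> colourings n k \<Longrightarrow> d \<in> colourings n k \<Longrightarrow> kernel_at n x c d = f c d"
  by (simp add: has_kernel_def)

text \<open>
  Each of the five terms attaches the ports of \<open>L\<^sub>i\<close> to the vertices of the columns \<open>i\<close> and \<open>i + 1\<close>
  in its own way; \<open>port_kernel\<close> is defined so that these terms are its summands.
\<close>

lemma L_kernel_step:
  assumes i: "Suc 0 \<le> i" "i < k"
    and L: "has_kernel k (L_elt k i) (L_kernel k i)"
    and sigma: "has_kernel k (sigma k (Suc i)) (sigma_kernel k i)"
  shows "has_kernel k (L_elt k (Suc i)) (L_kernel k (Suc i))"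
  unfolding has_kernel_def
proof (intro allI ballI)
  fix n c d assume cd: "c \<in> colourings n k" "d \<in> colourings n k"
  have lt: "c i < n" "c (Suc i) < n" "d i < n" "d (Suc i) < n"
    using cd i by (auto intro: colouringsD)
  obtain m where m: "i = Suc m" using i by (cases i) auto
  have i': "Suc i \<le> k" using i by auto
  note mem = L_elt_in_partition_algebra[of i k] in_partition_algebra
  note [simp] = i i' cd lt colourings_upd mem less_imp_le
    kernel_s_gen_product[where k = k] kernel_p_half_product[where k = k]
    kernel_p_gen_product[where k = k] has_kernelD[OF L] has_kernelD[OF sigma]
    agree_beyond_Suc[OF \<open>i < k\<close>]
  let ?s = "s_gen k i" and ?p = "p_half k i" and ?L = "L_elt k i"
  let ?A = "agree_beyond (Suc i) k c d" and ?f = "port_kernel i c d"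
  have 1: "kernel_at n (?s \<cdot> ?L \<cdot> ?p) c d =
      (if ?A \<and> c i = d i \<and> d i = d (Suc i) then ?f (c (Suc i)) (d i) else 0)"
    by (auto simp: L_kernel_def)
  have 2: "kernel_at n (?p \<cdot> ?L \<cdot> ?s) c d =
      (if ?A \<and> c i = c (Suc i) \<and> c i = d i then ?f (c i) (d (Suc i)) else 0)"
    by (auto simp: L_kernel_def)
  \<comment> \<open>\<open>p_gen k (i + 1)\<close> sums over the colours of column \<open>i + 1\<close>, where \<open>L_elt k i\<close> is the identity:
    only the colour \<open>c (Suc i)\<close> contributes.\<close>
  have 3: "kernel_at n (?p \<cdot> ?L \<cdot> p_gen k (i + 1) \<cdot> ?p) c d =
      (if ?A \<and> c i = c (Suc i) \<and> d i = d (Suc i) then ?f (c i) (d i) else 0)"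
    by (auto simp: L_kernel_def cong: sum.cong_simp if_cong)
  have 4: "kernel_at n (?s \<cdot> ?L \<cdot> ?s) c d =
      (if ?A \<and> c i = d i then ?f (c (Suc i)) (d (Suc i)) else 0)"
    by (auto simp: L_kernel_def)
  have 5: "kernel_at n (sigma k (Suc i)) c d =
      (if ?A \<and> c i = d (Suc i) \<and> c (Suc i) = d i then ?f (c i) (d i) else 0)"
    by (simp add: sigma_kernel_def)
  have "L_elt k (Suc i) = - (?s \<cdot> ?L \<cdot> ?p) - ?p \<cdot> ?L \<cdot> ?s + ?p \<cdot> ?L \<cdot> p_gen k (i + 1) \<cdot> ?p
       + ?s \<cdot> ?L \<cdot> ?s + sigma k (Suc i)"
    by (simp add: m Let_def)
  then show "kernel_at n (L_elt k (Suc i)) c d = L_kernel k (Suc i) c d"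
    by (simp only: kernel_add kernel_diff kernel_uminus 1 2 3 4 5)
      (simp add: L_kernel_def m Let_def del: agree_beyond_Suc)
qed

text \<open>
  All five terms in the recursions of \<open>sigma\<close> and \<open>sigma_half\<close> require the same equalities \<open>C\<close>
  between colours in the last two columns, and each has a condition of its own on the column
  before them.
\<close>

lemma guarded_sum:
  fixes v w x y z :: int
  shows "(if C \<and> P\<^sub>1 then v else 0) + (if C \<and> P\<^sub>2 then w else 0) + (if C \<and> P\<^sub>3 then x else 0)
      - (if C \<and> P\<^sub>4 then y else 0) - (if C \<and> P\<^sub>5 then z else 0) =
    (if C then (if P\<^sub>1 then v else 0) + (if P\<^sub>2 then w else 0) + (if P\<^sub>3 then x else 0)
      - (if P\<^sub>4 then y else 0) - (if P\<^sub>5 then z else 0) else 0)"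
  by (cases C) simp_all

text \<open>
  The five terms of the recursion for \<open>\<sigma>\<^sub>m\<^sub>+\<^sub>2\<close> are the five summands of \<open>L\<^sub>m\<^sub>+\<^sub>1\<close>, with the ports of \<open>L\<^sub>m\<^sub>+\<^sub>1\<close>
  coloured as the blocks \<open>{m + 1, (m + 2)'}\<close> and \<open>{(m + 1)', m + 2}\<close>. In the two negative terms the ports
  of \<open>L\<^sub>m\<close> appear in the opposite order, so that the symmetry of \<open>port_kernel\<close> is needed.
\<close>

lemma sigma_kernel_step:
  assumes m: "Suc 0 \<le> m" "Suc m < k"
    and L: "has_kernel k (L_elt k m) (L_kernel k m)"
    and sigma: "has_kernel k (sigma k (Suc m)) (sigma_kernel k m)"
  shows "has_kernel k (sigma k (Suc (Suc m))) (sigma_kernel k (Suc m))"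
  unfolding has_kernel_def
proof (intro allI ballI)
  fix n c d assume cd: "c \<in> colourings n k" "d \<in> colourings n k"
  have lt: "c m < n" "c (Suc m) < n" "c (Suc (Suc m)) < n" "d m < n" "d (Suc m) < n" "d (Suc (Suc m)) < n"
    using cd m by (auto intro: colouringsD)
  have m': "m < k" "Suc m \<le> k" "m \<le> k" "Suc 0 \<le> Suc m" using m by auto
  obtain l where l: "m = Suc l" using m by (cases m) auto
  note [simp] = m m' cd lt colourings_upd in_partition_algebra
    L_elt_in_partition_algebra sigma_in_partition_algebra sigma_half_in_partition_algebra
    kernel_s_gen_product[where k = k] kernel_p_half_product[where k = k]
    has_kernelD[OF L] has_kernelD[OF sigma]
    agree_beyond_Suc[OF \<open>m < k\<close>] agree_beyond_Suc[OF \<open>Suc m < k\<close>]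
  let ?s = "s_gen k m" and ?s' = "s_gen k (Suc m)" and ?p = "p_half k m" and ?p' = "p_half k (Suc m)"
  let ?P = "p_gen k (Suc m)" and ?L = "L_elt k m" and ?S = "sigma k (Suc m)"
  let ?f = "port_kernel m c d"
  let ?a = "c (Suc m)" and ?b = "c (Suc (Suc m))" and ?a' = "d (Suc m)" and ?b' = "d (Suc (Suc m))"
  let ?C = "?a = ?b' \<and> ?b = ?a' \<and> agree_beyond (Suc (Suc m)) k c d"
  \<comment> \<open>Each word is bracketed so that the generators can be stripped off one at a time, first
    those on the right of \<open>?S\<close> or \<open>?L\<close> and then those on the left.\<close>
  have assoc1: "?s \<cdot> ?s' \<cdot> ?S \<cdot> ?s' \<cdot> ?s = ?s \<cdot> (?s' \<cdot> ?S) \<cdot> ?s' \<cdot> ?s"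
    by (simp add: product_assoc[where k = k])
  have 1: "kernel_at n (?s \<cdot> ?s' \<cdot> ?S \<cdot> ?s' \<cdot> ?s) c d =
      (if ?C \<and> c m = d m then ?f ?a ?a' else 0)"
    unfolding assoc1 by (auto simp: L_kernel_def sigma_kernel_def)
  have assoc2: "?s' \<cdot> ?p \<cdot> ?L \<cdot> ?s' \<cdot> ?p \<cdot> ?s' = ?s' \<cdot> (?p \<cdot> ?L) \<cdot> ?s' \<cdot> ?p \<cdot> ?s'"
    by (simp add: product_assoc[where k = k])
  have 2: "kernel_at n (?s' \<cdot> ?p \<cdot> ?L \<cdot> ?s' \<cdot> ?p \<cdot> ?s') c d =
      (if ?C \<and> c m = ?a' \<and> d m = ?a then ?f (c m) (d m) else 0)"
    unfolding assoc2 by (auto simp: L_kernel_def sigma_kernel_def)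
  have 3: "kernel_at n (?p \<cdot> ?L \<cdot> ?s' \<cdot> ?p) c d =
      (if ?C \<and> c m = ?a \<and> d m = ?a' then ?f (c m) (d m) else 0)"
    by (auto simp: L_kernel_def sigma_kernel_def)
  have assoc4: "?s' \<cdot> ?p \<cdot> ?L \<cdot> ?s \<cdot> ?p' \<cdot> ?P \<cdot> ?p = ?s' \<cdot> (?p \<cdot> ?L) \<cdot> ?s \<cdot> ?p' \<cdot> ?P \<cdot> ?p"
    by (simp add: product_assoc[where k = k])
  have 4: "kernel_at n (?s' \<cdot> ?p \<cdot> ?L \<cdot> ?s \<cdot> ?p' \<cdot> ?P \<cdot> ?p) c d =
      (if ?C \<and> c m = ?a' \<and> c m = d m then ?f ?a (c m) else 0)"
    unfolding assoc4 by (subst kernel_right_triple[where k = k]) (auto simp: L_kernel_def port_kernel_sym)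
  \<comment> \<open>A name of its own for this product keeps the simplifier from stripping off its generators one
    by one, so that they are evaluated together by \<open>kernel_left_triple\<close>.\<close>
  define X where "X = ?p \<cdot> (?P \<cdot> (?p' \<cdot> (?s \<cdot> ?L)))"
  have [simp]: "X \<in> partition_algebra k" by (simp add: X_def)
  have [simp]: "kernel_at n X c' d' = (if c' m = c' (Suc m)
      then kernel_at n (?s \<cdot> ?L) (c'(Suc m := c' (Suc (Suc m)))) d' else 0)"
    if "c' \<in> colourings n k" "d' \<in> colourings n k" for c' d'
    unfolding X_def using that by (intro kernel_left_triple[where k = k]) simp_all
  have assoc5: "?p \<cdot> ?P \<cdot> ?p' \<cdot> ?s \<cdot> ?L \<cdot> ?p \<cdot> ?s' = X \<cdot> ?p \<cdot> ?s'"
    by (simp add: X_def product_assoc[where k = k])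
  have 5: "kernel_at n (?p \<cdot> ?P \<cdot> ?p' \<cdot> ?s \<cdot> ?L \<cdot> ?p \<cdot> ?s') c d =
      (if ?C \<and> c m = ?a \<and> c m = d m then ?f (c m) ?a' else 0)"
    unfolding assoc5 by (auto simp: L_kernel_def port_kernel_sym)
  have rec: "sigma k (Suc (Suc m)) =
      ?s \<cdot> ?s' \<cdot> ?S \<cdot> ?s' \<cdot> ?s
      + ?s' \<cdot> ?p \<cdot> ?L \<cdot> ?s' \<cdot> ?p \<cdot> ?s'
      + ?p \<cdot> ?L \<cdot> ?s' \<cdot> ?p
      - ?s' \<cdot> ?p \<cdot> ?L \<cdot> ?s \<cdot> ?p' \<cdot> ?P \<cdot> ?p
      - ?p \<cdot> ?P \<cdot> ?p' \<cdot> ?s \<cdot> ?L \<cdot> ?p \<cdot> ?s'"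
    by (simp add: l Let_def)
  show "kernel_at n (sigma k (Suc (Suc m))) c d = sigma_kernel k (Suc m) c d"
    unfolding rec sigma_kernel_def kernel_add kernel_diff 1 2 3 4 5 port_kernel_Suc_regrouped[OF m(1)]
    by (rule guarded_sum)
qed

text \<open>
  As for \<open>sigma\<close>, now with the ports of \<open>L\<^sub>m\<^sub>+\<^sub>1\<close> coloured as \<open>{m + 1, (m + 1)'}\<close> and \<open>{m + 2, (m + 2)'}\<close>.
  The ports of \<open>L\<^sub>m\<close> appear in the right order here, but the terms two and three as well as four and
  five have to be exchanged to match \<open>port_kernel_Suc_regrouped\<close>.
\<close>

lemma sigma_half_kernel_step:
  assumes m: "Suc 0 \<le> m" "Suc m < k"
    and L: "has_kernel k (L_elt k m) (L_kernel k m)"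
    and sigma_half: "has_kernel k (sigma_half k m) (sigma_half_kernel k m)"
  shows "has_kernel k (sigma_half k (Suc m)) (sigma_half_kernel k (Suc m))"
  unfolding has_kernel_def
proof (intro allI ballI)
  fix n c d assume cd: "c \<in> colourings n k" "d \<in> colourings n k"
  have lt: "c m < n" "c (Suc m) < n" "c (Suc (Suc m)) < n" "d m < n" "d (Suc m) < n" "d (Suc (Suc m)) < n"
    using cd m by (auto intro: colouringsD)
  have m': "m < k" "Suc m \<le> k" "m \<le> k" "Suc 0 \<le> Suc m" using m by auto
  obtain l where l: "m = Suc l" using m by (cases m) auto
  note [simp] = m m' cd lt colourings_upd in_partition_algebra
    L_elt_in_partition_algebra sigma_in_partition_algebra sigma_half_in_partition_algebra
    kernel_s_gen_product[where k = k] kernel_p_half_product[where k = k]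
    has_kernelD[OF L] has_kernelD[OF sigma_half]
    agree_beyond_Suc[OF \<open>m < k\<close>] agree_beyond_Suc[OF \<open>Suc m < k\<close>]
  let ?s = "s_gen k m" and ?s' = "s_gen k (Suc m)" and ?p = "p_half k m" and ?p' = "p_half k (Suc m)"
  let ?P = "p_gen k (Suc m)" and ?L = "L_elt k m" and ?S = "sigma_half k m"
  let ?f = "port_kernel m c d"
  let ?a = "c (Suc m)" and ?b = "c (Suc (Suc m))" and ?a' = "d (Suc m)" and ?b' = "d (Suc (Suc m))"
  let ?C = "?a = ?a' \<and> ?b = ?b' \<and> agree_beyond (Suc (Suc m)) k c d"
  have assoc1: "?s \<cdot> ?s' \<cdot> ?S \<cdot> ?s' \<cdot> ?s = ?s \<cdot> (?s' \<cdot> ?S) \<cdot> ?s' \<cdot> ?s"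
    by (simp add: product_assoc[where k = k])
  have 1: "kernel_at n (?s \<cdot> ?s' \<cdot> ?S \<cdot> ?s' \<cdot> ?s) c d =
      (if ?C \<and> c m = d m then ?f ?a ?b else 0)"
    unfolding assoc1 by (auto simp: L_kernel_def sigma_half_kernel_def)
  have 2: "kernel_at n (?p \<cdot> ?L \<cdot> ?s' \<cdot> ?p \<cdot> ?s') c d =
      (if ?C \<and> c m = ?a \<and> d m = ?b then ?f (c m) (d m) else 0)"
    by (auto simp: L_kernel_def sigma_half_kernel_def)
  have assoc3: "?s' \<cdot> ?p \<cdot> ?L \<cdot> ?s' \<cdot> ?p = ?s' \<cdot> (?p \<cdot> ?L) \<cdot> ?s' \<cdot> ?p"
    by (simp add: product_assoc[where k = k])
  have 3: "kernel_at n (?s' \<cdot> ?p \<cdot> ?L \<cdot> ?s' \<cdot> ?p) c d =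
      (if ?C \<and> c m = ?b \<and> d m = ?a then ?f (c m) (d m) else 0)"
    unfolding assoc3 by (auto simp: L_kernel_def sigma_half_kernel_def)
  have 4: "kernel_at n (?p \<cdot> ?L \<cdot> ?s \<cdot> ?p' \<cdot> ?P \<cdot> ?p) c d =
      (if ?C \<and> c m = ?a \<and> c m = d m then ?f (c m) ?b else 0)"
    by (subst kernel_right_triple[where k = k]) (auto simp: L_kernel_def)
  \<comment> \<open>A name of its own for this product keeps the simplifier from stripping off its generators one
    by one, so that they are evaluated together by \<open>kernel_left_triple\<close>.\<close>
  define X where "X = ?p \<cdot> (?P \<cdot> (?p' \<cdot> (?s \<cdot> ?L)))"
  have [simp]: "X \<in> partition_algebra k" by (simp add: X_def)
  have [simp]: "kernel_at n X c' d' = (if c' m = c' (Suc m)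
      then kernel_at n (?s \<cdot> ?L) (c'(Suc m := c' (Suc (Suc m)))) d' else 0)"
    if "c' \<in> colourings n k" "d' \<in> colourings n k" for c' d'
    unfolding X_def using that by (intro kernel_left_triple[where k = k]) simp_all
  have assoc5: "?s' \<cdot> ?p \<cdot> ?P \<cdot> ?p' \<cdot> ?s \<cdot> ?L \<cdot> ?p \<cdot> ?s' = ?s' \<cdot> X \<cdot> ?p \<cdot> ?s'"
    by (simp add: X_def product_assoc[where k = k])
  have 5: "kernel_at n (?s' \<cdot> ?p \<cdot> ?P \<cdot> ?p' \<cdot> ?s \<cdot> ?L \<cdot> ?p \<cdot> ?s') c d =
      (if ?C \<and> c m = ?b \<and> c m = d m then ?f ?a (c m) else 0)"
    unfolding assoc5 by (auto simp: L_kernel_def)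
  have rec: "sigma_half k (Suc m) =
      ?s \<cdot> ?s' \<cdot> ?S \<cdot> ?s' \<cdot> ?s
      + ?s' \<cdot> ?p \<cdot> ?L \<cdot> ?s' \<cdot> ?p
      + ?p \<cdot> ?L \<cdot> ?s' \<cdot> ?p \<cdot> ?s'
      - ?s' \<cdot> ?p \<cdot> ?P \<cdot> ?p' \<cdot> ?s \<cdot> ?L \<cdot> ?p \<cdot> ?s'
      - ?p \<cdot> ?L \<cdot> ?s \<cdot> ?p' \<cdot> ?P \<cdot> ?p"
    by (simp add: l Let_def algebra_simps)
  show "kernel_at n (sigma_half k (Suc m)) c d = sigma_half_kernel k (Suc m) c d"
    unfolding rec sigma_half_kernel_def kernel_add kernel_diff 1 3 2 5 4 port_kernel_Suc_regrouped[OF m(1)]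
    by (rule guarded_sum)
qed

lemma kernel_L_and_sigma:
  assumes "i < k"
  shows "1 \<le> i \<Longrightarrow> has_kernel k (L_elt k i) (L_kernel k i) \<and> has_kernel k (sigma k (Suc i)) (sigma_kernel k i)"
  using assms
proof (induction i)
  case 0
  then show ?case by simp
next
  case (Suc m)
  show ?case
  proof (cases m)
    case 0
    then have k: "1 \<le> (1::nat)" "1 < k" using Suc.prems by auto
    have "{1..k} - {1} = {1<..k}" by auto
    then have "has_kernel k (L_elt k 1) (L_kernel k 1)"
      using k by (simp add: has_kernel_def L_kernel_def kernel_at_p_gen(3) agree_beyond_def)
    moreover have "{1..k} - {1, 1 + 1} = {Suc 1<..k}" by auto
    then have "kernel_at n (s_gen k 1) c d = sigma_kernel k 1 c d" for n c d
      unfolding kernel_at_s_gen(3)[OF k] sigma_kernel_def agree_beyond_def by simp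
    then have "has_kernel k (sigma k (Suc 1)) (sigma_kernel k 1)"
      by (simp add: has_kernel_def)
    ultimately show ?thesis using 0 by simp
  next
    case (Suc _)
    then have "has_kernel k (L_elt k m) (L_kernel k m)"
      "has_kernel k (sigma k (Suc m)) (sigma_kernel k m)"
      using Suc.IH Suc.prems by auto
    then show ?thesis
      using L_kernel_step[of m k] sigma_kernel_step[of m k] Suc Suc.prems by auto
  qed
qed

lemma kernel_sigma_half:
  assumes "i < k"
  shows "1 \<le> i \<Longrightarrow> has_kernel k (sigma_half k i) (sigma_half_kernel k i)"
  using assms
proof (induction i)
  case 0
  then show ?case by simp
next
  case (Suc m)
  show ?case
  proof (cases m)
    case 0
    then have k: "1 \<le> (1::nat)" "1 < k" using Suc.prems by auto
    have "{1..k} - {1, 1 + 1} = {Suc 1<..k}" by auto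
    then have "kernel_at n (unit_elt k) c d = sigma_half_kernel k 1 c d" for n c d
      unfolding kernel_at_unit ball_columns[OF k] sigma_half_kernel_def agree_beyond_def by simp
    then show ?thesis using 0 by (simp add: has_kernel_def)
  next
    case (Suc _)
    then have "has_kernel k (sigma_half k m) (sigma_half_kernel k m)"
      using Suc.IH Suc.prems by auto
    then show ?thesis
      using sigma_half_kernel_step[of m k] kernel_L_and_sigma[of m k] Suc Suc.prems by auto
  qed
qed

theorem proposition3p4:
  fixes i k :: nat
  assumes "1 \<le> i" and "i + 1 \<le> k"
  shows "sigma_half k i \<cdot> s_gen k i = s_gen k i \<cdot> sigma_half k i
       \<and> s_gen k i \<cdot> sigma_half k i = sigma k (i + 1)"
proof -
  have i: "1 \<le> i" "i < k" using assms by auto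
  note half = has_kernelD[OF kernel_sigma_half[OF i(2,1)]]
  note sigma = has_kernelD[OF conjunct2[OF kernel_L_and_sigma[OF i(2,1)]]]
  note mem = s_gen_in_partition_algebra[OF i] sigma_half_in_partition_algebra[OF i(2)]
    in_partition_algebra_product sigma_in_partition_algebra[of "Suc i" k]
  have swap: "c(i := c (Suc i), Suc i := c i) \<in> colourings n k"
    if "c \<in> colourings n k" for c n
    using that i by (auto simp: colourings_def)
  have "s_gen k i \<cdot> sigma_half k i = sigma k (Suc i)"
  proof (rule element_eqI_kernel)
    fix n c d assume cd: "c \<in> colourings n k" "d \<in> colourings n k"
    have "kernel_at n (s_gen k i \<cdot> sigma_half k i) c d =
        sigma_half_kernel k i (c(i := c (Suc i), Suc i := c i)) d"
      using half[OF swap[OF cd(1)] cd(2)]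
      by (simp only: kernel_s_gen_product(1)[OF mem(2) cd i])
    \<comment> \<open>The exchange of \<open>i\<close> and \<open>i + 1\<close> in the top row also exchanges the ports.\<close>
    also have "\<dots> = sigma_kernel k i c d"
      by (auto simp: sigma_half_kernel_def sigma_kernel_def port_kernel_sym)
    also have "\<dots> = kernel_at n (sigma k (Suc i)) c d"
      using sigma[OF cd] by simp
    finally show "kernel_at n (s_gen k i \<cdot> sigma_half k i) c d = kernel_at n (sigma k (Suc i)) c d" .
  qed (use mem i in auto)
  moreover have "sigma_half k i \<cdot> s_gen k i = sigma k (Suc i)"
  proof (rule element_eqI_kernel)
    fix n c d assume cd: "c \<in> colourings n k" "d \<in> colourings n k"
    have "kernel_at n (sigma_half k i \<cdot> s_gen k i) c d =
        sigma_half_kernel k i c (d(i := d (Suc i), Suc i := d i))"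
      using half[OF cd(1) swap[OF cd(2)]]
      by (simp only: kernel_s_gen_product(2)[OF mem(2) cd i])
    also have "\<dots> = sigma_kernel k i c d"
      by (auto simp: sigma_half_kernel_def sigma_kernel_def)
    also have "\<dots> = kernel_at n (sigma k (Suc i)) c d"
      using sigma[OF cd] by simp
    finally show "kernel_at n (sigma_half k i \<cdot> s_gen k i) c d = kernel_at n (sigma k (Suc i)) c d" .
  qed (use mem i in auto)
  ultimately show ?thesis by simp
qed

end
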